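(* Let $F$ be a topological field and $X$ a compact $F$-Tychonoff space. Then the Zariski topology and the Gelfand topology on $\mathrm{Max}(C(X,F))$ coincide.
   Context: Topological fields have continuous addition, multiplication and inversion and are proper (not indiscrete), hence Hausdorff. A space $X$ is $F$-Tychonoff if it is $T_1$ and for every closed $C\subset X$ and $x\in X\setminus C$ there is a continuous $f:X\to F$ with $f(x)=1$ and $f|_C=0$. $C(X,F)$ is the $F$-algebra of continuous functions $X\to F$. A commutative unital $F$-algebra $A$ is Gelfand if for every maximal ideal $M$ the canonical map $F\to A/M$ is an isomorphism, so $a+M$ is regarded as an element of $F$; $C(X,F)$ is Gelfand for $X$ compact Hausdorff. On the set $\mathrm{Max}(A)$ of maximal ideals, the Zariski topology has basic open sets $D(a)=\{M: a\notin M\}$, $a\in A$; for $A$ Gelfand, the Gelfand topology is the weakest topology making all evaluations $ev_a:\mathrm{Max}(A)\to F$, $ev_a(M)=a+M$, continuous. *)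

theory Defs
  imports "HOL-Analysis.Analysis" "HOL-Algebra.Module" "HOL-Algebra.QuotRing"
begin

section \<open>Topological fields\<close>

locale topological_field = field F for F :: "('f, 'm) ring_scheme" (structure) +
  fixes T :: "'f topology"
  assumes topspace_eq: "topspace T = carrier F"
    and continuous_add: "continuous_map (prod_topology T T) T (\<lambda>(a, b). a \<oplus> b)"
    and continuous_mult: "continuous_map (prod_topology T T) T (\<lambda>(a, b). a \<otimes> b)"
    and continuous_inv: "continuous_map (subtopology T (carrier F - {\<zero>})) T (\<lambda>a. inv a)"
    and not_indiscrete: "\<exists>U. openin T U \<and> U \<noteq> {} \<and> U \<noteq> carrier F"

definition tychonoff_over ::
    "('f, 'm) ring_scheme \<Rightarrow> 'f topology \<Rightarrow> 's topology \<Rightarrow> bool" where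
  "tychonoff_over F T S \<longleftrightarrow>
     t1_space S \<and>
     (\<forall>C x. closedin S C \<and> x \<in> topspace S - C \<longrightarrow>
       (\<exists>f. continuous_map S T f \<and> f x = \<one>\<^bsub>F\<^esub> \<and> (\<forall>y\<in>C. f y = \<zero>\<^bsub>F\<^esub>)))"


section \<open>The algebra of continuous functions\<close>

text \<open>Functions are made extensional, so that elements of the carrier agreeing on
  \<^term>\<open>topspace S\<close> are equal.\<close>

definition cont_algebra ::
    "('f, 'm) ring_scheme \<Rightarrow> 'f topology \<Rightarrow> 's topology \<Rightarrow> ('f, 's \<Rightarrow> 'f) module" where
  "cont_algebra F T S =
    \<lparr> carrier = {f \<in> extensional (topspace S). continuous_map S T f},
      mult = (\<lambda>f g. \<lambda>x\<in>topspace S. f x \<otimes>\<^bsub>F\<^esub> g x),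
      one = (\<lambda>x\<in>topspace S. \<one>\<^bsub>F\<^esub>),
      ring.zero = (\<lambda>x\<in>topspace S. \<zero>\<^bsub>F\<^esub>),
      add = (\<lambda>f g. \<lambda>x\<in>topspace S. f x \<oplus>\<^bsub>F\<^esub> g x),
      smult = (\<lambda>c f. \<lambda>x\<in>topspace S. c \<otimes>\<^bsub>F\<^esub> f x) \<rparr>"


section \<open>Maximal spectrum\<close>

definition Max_spec :: "('a, 'm) ring_scheme \<Rightarrow> 'a set set" where
  "Max_spec A = {M. maximalideal M A}"

definition zariski_open :: "('a, 'm) ring_scheme \<Rightarrow> 'a \<Rightarrow> 'a set set" where
  "zariski_open A a = {M \<in> Max_spec A. a \<notin> M}"

definition zariski_topology :: "('a, 'm) ring_scheme \<Rightarrow> 'a set topology" where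
  "zariski_topology A = topology_generated_by (zariski_open A ` carrier A)"

definition scalar_coset ::
    "('f, 'a, 'n) module_scheme \<Rightarrow> 'a set \<Rightarrow> 'f \<Rightarrow> 'a set" where
  "scalar_coset A M c = M +>\<^bsub>A\<^esub> (c \<odot>\<^bsub>A\<^esub> \<one>\<^bsub>A\<^esub>)"

text \<open>The constant \<^const>\<open>Module.algebra\<close> is qualified because the measure theory library
  has a locale of the same name.\<close>

definition gelfand_algebra ::
    "('f, 'm) ring_scheme \<Rightarrow> ('f, 'a, 'n) module_scheme \<Rightarrow> bool" where
  "gelfand_algebra F A \<longleftrightarrow>
     Module.algebra F A \<and>
     (\<forall>M \<in> Max_spec A. scalar_coset A M \<in> ring_iso F (A Quot M))"

text \<open>The element of \<open>F\<close> corresponding to the coset of \<open>a\<close>; only meaningful if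
  \<^const>\<open>scalar_coset\<close> is bijective, see \<open>gelfand_ev\<close> below.\<close>

definition ev ::
    "('f, 'm) ring_scheme \<Rightarrow> ('f, 'a, 'n) module_scheme \<Rightarrow> 'a \<Rightarrow> 'a set \<Rightarrow> 'f" where
  "ev F A a M = the_inv_into (carrier F) (scalar_coset A M) (M +>\<^bsub>A\<^esub> a)"

definition gelfand_topology ::
    "('f, 'm) ring_scheme \<Rightarrow> 'f topology \<Rightarrow> ('f, 'a, 'n) module_scheme \<Rightarrow> 'a set topology" where
  "gelfand_topology F T A =
     topology_generated_by
       {{M \<in> Max_spec A. ev F A a M \<in> U} | a U. a \<in> carrier A \<and> openin T U}"


section \<open>Basic properties\<close>

context topological_field
begin

lemma continuous_map_carrier:
  "\<lbrakk>continuous_map S T f; x \<in> topspace S\<rbrakk> \<Longrightarrow> f x \<in> carrier F"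
  by (metis PiE continuous_map_def topspace_eq)

lemma continuous_map_add:
  assumes "continuous_map S T f" "continuous_map S T g"
  shows "continuous_map S T (\<lambda>x. f x \<oplus> g x)"
  using continuous_map_compose[OF continuous_map_pairedI[OF assms] continuous_add]
  by (simp add: o_def)

lemma continuous_map_mult:
  assumes "continuous_map S T f" "continuous_map S T g"
  shows "continuous_map S T (\<lambda>x. f x \<otimes> g x)"
  using continuous_map_compose[OF continuous_map_pairedI[OF assms] continuous_mult]
  by (simp add: o_def)

lemma cont_algebra_carrierI:
  "continuous_map S T f \<Longrightarrow> restrict f (topspace S) \<in> carrier (cont_algebra F T S)"
  by (auto simp: cont_algebra_def intro: continuous_map_eq)

lemma cont_algebra_is_algebra: "Module.algebra F (cont_algebra F T S)"
proof -
  let ?C = "cont_algebra F T S"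
  have carr: "f x \<in> carrier F" if "f \<in> carrier ?C" "x \<in> topspace S" for f x
    using that by (auto simp: cont_algebra_def intro: continuous_map_carrier)
  have cont: "continuous_map S T f" if "f \<in> carrier ?C" for f
    using that by (auto simp: cont_algebra_def)
  have const: "continuous_map S T (\<lambda>x. c)" if "c \<in> carrier F" for c
    using that by (simp add: topspace_eq)
  have eqI: "f = g" if "f \<in> carrier ?C" "g \<in> carrier ?C"
      "\<And>x. x \<in> topspace S \<Longrightarrow> f x = g x" for f g
    using that by (auto simp: cont_algebra_def intro: extensionalityI)
  have add: "f \<oplus>\<^bsub>?C\<^esub> g = (\<lambda>x\<in>topspace S. f x \<oplus> g x)" for f g
    by (simp add: cont_algebra_def)
  have mult: "f \<otimes>\<^bsub>?C\<^esub> g = (\<lambda>x\<in>topspace S. f x \<otimes> g x)" for f g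
    by (simp add: cont_algebra_def)
  have zero: "\<zero>\<^bsub>?C\<^esub> = (\<lambda>x\<in>topspace S. \<zero>)"
    by (simp add: cont_algebra_def)
  have one: "\<one>\<^bsub>?C\<^esub> = (\<lambda>x\<in>topspace S. \<one>)"
    by (simp add: cont_algebra_def)
  have smult: "c \<odot>\<^bsub>?C\<^esub> f = (\<lambda>x\<in>topspace S. c \<otimes> f x)" for c f
    by (simp add: cont_algebra_def)
  note ops = add mult zero one smult
  have addC: "f \<oplus>\<^bsub>?C\<^esub> g \<in> carrier ?C" if "f \<in> carrier ?C" "g \<in> carrier ?C" for f g
    unfolding add using that by (intro cont_algebra_carrierI continuous_map_add cont)
  have multC: "f \<otimes>\<^bsub>?C\<^esub> g \<in> carrier ?C" if "f \<in> carrier ?C" "g \<in> carrier ?C" for f g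
    unfolding mult using that by (intro cont_algebra_carrierI continuous_map_mult cont)
  have zeroC: "\<zero>\<^bsub>?C\<^esub> \<in> carrier ?C"
    unfolding zero by (intro cont_algebra_carrierI const) simp
  have oneC: "\<one>\<^bsub>?C\<^esub> \<in> carrier ?C"
    unfolding one by (intro cont_algebra_carrierI const) simp
  have smultC: "c \<odot>\<^bsub>?C\<^esub> f \<in> carrier ?C" if "c \<in> carrier F" "f \<in> carrier ?C" for c f
    unfolding smult using that by (intro cont_algebra_carrierI continuous_map_mult cont const)
  have inv: "\<exists>g\<in>carrier ?C. g \<oplus>\<^bsub>?C\<^esub> f = \<zero>\<^bsub>?C\<^esub>" if f: "f \<in> carrier ?C" for f
  proof
    show g: "(\<ominus> \<one>) \<odot>\<^bsub>?C\<^esub> f \<in> carrier ?C"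
      using f by (intro smultC) simp_all
    show "(\<ominus> \<one>) \<odot>\<^bsub>?C\<^esub> f \<oplus>\<^bsub>?C\<^esub> f = \<zero>\<^bsub>?C\<^esub>"
      using f by (intro eqI addC g zeroC) (simp_all add: ops carr l_minus l_neg)
  qed
  have ab: "abelian_group ?C"
    by (rule abelian_groupI; (intro eqI addC zeroC inv)?)
      (simp_all add: ops carr a_ac addC[unfolded ops] zeroC[unfolded ops])
  have cm: "comm_monoid ?C"
    by (rule comm_monoidI; (intro eqI multC oneC)?)
      (simp_all add: ops carr m_ac multC[unfolded ops] oneC[unfolded ops])
  have cr: "cring ?C"
    by (rule cringI[OF ab cm], intro eqI addC multC)
      (simp_all add: ops carr l_distr)
  show ?thesis
    by (rule algebraI; (intro cr is_cring smultC eqI addC multC)?)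
      (simp_all add: ops carr l_distr r_distr m_assoc)
qed

end

text \<open>The sets \<^const>\<open>zariski_open\<close> form a base, not only a subbase.\<close>

lemma zariski_open_mult:
  assumes "cring A" "a \<in> carrier A" "b \<in> carrier A"
  shows "zariski_open A (a \<otimes>\<^bsub>A\<^esub> b) = zariski_open A a \<inter> zariski_open A b"
proof -
  interpret cring A by fact
  have "a \<otimes>\<^bsub>A\<^esub> b \<in> M \<longleftrightarrow> a \<in> M \<or> b \<in> M" if "maximalideal M A" for M
  proof -
    interpret primeideal M A using that by (rule maximalideal_prime)
    show ?thesis
      using I_prime[OF assms(2,3)] I_l_closed[OF _ assms(2), of b]
        I_r_closed[OF _ assms(3), of a] by blast
  qed
  then show ?thesis by (simp add: zariski_open_def Max_spec_def set_eq_iff) blast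
qed

lemma openin_zariski_topology:
  assumes "cring A"
  shows "openin (zariski_topology A) U \<longleftrightarrow> (\<exists>S\<subseteq>carrier A. U = (\<Union>a\<in>S. zariski_open A a))"
proof
  assume "openin (zariski_topology A) U"
  then have "generate_topology_on (zariski_open A ` carrier A) U"
    by (simp add: zariski_topology_def openin_topology_generated_by_iff)
  then show "\<exists>S\<subseteq>carrier A. U = (\<Union>a\<in>S. zariski_open A a)"
  proof induction
    case Empty
    then show ?case by (intro exI[of _ "{}"]) auto
  next
    case (Int U V)
    from Int.IH(1) obtain S where S: "S \<subseteq> carrier A" "U = (\<Union>a\<in>S. zariski_open A a)"
      by (elim exE conjE)
    from Int.IH(2) obtain R where R: "R \<subseteq> carrier A" "V = (\<Union>a\<in>R. zariski_open A a)"
      by (elim exE conjE)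
    interpret cring A by fact
    have "zariski_open A (a \<otimes>\<^bsub>A\<^esub> b) = zariski_open A a \<inter> zariski_open A b"
      if "a \<in> S" "b \<in> R" for a b
      using that S(1) R(1) by (intro zariski_open_mult assms) auto
    then have "U \<inter> V = (\<Union>(a, b)\<in>S \<times> R. zariski_open A (a \<otimes>\<^bsub>A\<^esub> b))"
      by (fastforce simp: S(2) R(2))
    then show ?case
      using S R by (intro exI[of _ "(\<lambda>(a, b). a \<otimes>\<^bsub>A\<^esub> b) ` (S \<times> R)"]) auto
  next
    case (UN K)
    then obtain S where S: "\<And>k. k \<in> K \<Longrightarrow> S k \<subseteq> carrier A"
        "\<And>k. k \<in> K \<Longrightarrow> k = (\<Union>a\<in>S k. zariski_open A a)"
      by metis
    have "\<Union>K = (\<Union>k\<in>K. k)"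
      by simp
    also have "\<dots> = (\<Union>k\<in>K. \<Union>a\<in>S k. zariski_open A a)"
      by (rule SUP_cong[OF refl S(2)])
    also have "\<dots> = (\<Union>a\<in>(\<Union>k\<in>K. S k). zariski_open A a)"
      by (rule UN_UN_flatten[symmetric])
    finally show ?case
      using UN_least[of K S "carrier A", OF S(1)] by (intro exI conjI)
  next
    case (Basis s)
    then obtain a where "a \<in> carrier A" "s = zariski_open A a" by blast
    then show ?case by (intro exI[of _ "{a}"]) auto
  qed
next
  assume "\<exists>S\<subseteq>carrier A. U = (\<Union>a\<in>S. zariski_open A a)"
  then obtain S where S: "S \<subseteq> carrier A" "U = (\<Union>a\<in>S. zariski_open A a)"
    by (elim exE conjE)
  have "openin (zariski_topology A) (zariski_open A a)" if "a \<in> S" for a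
    unfolding zariski_topology_def using that S(1) by (intro topology_generated_by_Basis) auto
  then show "openin (zariski_topology A) U"
    unfolding S(2) by (intro openin_Union) auto
qed

lemma topspace_zariski_topology:
  assumes "cring A"
  shows "topspace (zariski_topology A) = Max_spec A"
proof -
  interpret cring A by fact
  have "\<one>\<^bsub>A\<^esub> \<notin> M" if "maximalideal M A" for M
    using that ideal.one_imp_carrier maximalideal.I_notcarr maximalideal.axioms(1) by metis
  then show ?thesis
    by (force simp: zariski_topology_def topology_generated_by_topspace zariski_open_def
        Max_spec_def)
qed

lemma gelfand_ev:
  assumes "gelfand_algebra F A" "M \<in> Max_spec A" "a \<in> carrier A"
  shows "ev F A a M \<in> carrier F"
    and "M +>\<^bsub>A\<^esub> (ev F A a M \<odot>\<^bsub>A\<^esub> \<one>\<^bsub>A\<^esub>) = M +>\<^bsub>A\<^esub> a"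
proof -
  interpret maximalideal M A using assms(2) by (simp add: Max_spec_def)
  have bij: "bij_betw (scalar_coset A M) (carrier F) (carrier (A Quot M))"
    using assms by (auto simp: gelfand_algebra_def ring_iso_def)
  have mem: "M +>\<^bsub>A\<^esub> a \<in> carrier (A Quot M)"
    using assms(3) by (simp add: FactRing_def a_rcosetsI[OF a_subset])
  show "ev F A a M \<in> carrier F"
    unfolding ev_def using the_inv_into_into[of "scalar_coset A M"] bij mem
    by (auto simp: bij_betw_def)
  show "M +>\<^bsub>A\<^esub> (ev F A a M \<odot>\<^bsub>A\<^esub> \<one>\<^bsub>A\<^esub>) = M +>\<^bsub>A\<^esub> a"
    using f_the_inv_into_f_bij_betw[OF bij] mem
    by (simp add: ev_def scalar_coset_def)
qed

text \<open>\<^const>\<open>gelfand_topology\<close> is the weakest topology on \<^const>\<open>Max_spec\<close>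
  making all evaluations continuous.\<close>

lemma
  assumes "topological_field F T" "gelfand_algebra F A"
  shows topspace_gelfand_topology: "topspace (gelfand_topology F T A) = Max_spec A"
    and continuous_map_gelfand_ev:
      "a \<in> carrier A \<Longrightarrow> continuous_map (gelfand_topology F T A) T (ev F A a)"
    and gelfand_topology_weakest:
      "\<lbrakk>topspace Y = Max_spec A; \<And>a. a \<in> carrier A \<Longrightarrow> continuous_map Y T (ev F A a);
        openin (gelfand_topology F T A) U\<rbrakk> \<Longrightarrow> openin Y U"
proof -
  interpret topological_field F T by fact
  interpret A: cring A
    using assms(2) by (simp add: gelfand_algebra_def Module.algebra_def)
  have mem: "ev F A a M \<in> topspace T" if "M \<in> Max_spec A" "a \<in> carrier A" for a M
    using gelfand_ev(1)[OF assms(2) that] by (simp add: topspace_eq)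
  let ?B = "{{M \<in> Max_spec A. ev F A a M \<in> U} | a U. a \<in> carrier A \<and> openin T U}"
  have "{M \<in> Max_spec A. ev F A \<zero>\<^bsub>A\<^esub> M \<in> topspace T} = Max_spec A"
    using mem A.zero_closed by blast
  moreover have "{M \<in> Max_spec A. ev F A \<zero>\<^bsub>A\<^esub> M \<in> topspace T} \<in> ?B"
    using A.zero_closed openin_topspace by blast
  ultimately have "Max_spec A \<in> ?B" by (rule subst)
  then have "\<Union>?B = Max_spec A" by blast
  then show top: "topspace (gelfand_topology F T A) = Max_spec A"
    unfolding gelfand_topology_def topology_generated_by_topspace .
  show "continuous_map (gelfand_topology F T A) T (ev F A a)" if "a \<in> carrier A"
    using that mem unfolding continuous_map top
    by (auto simp: gelfand_topology_def intro!: topology_generated_by_Basis)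
  show "openin Y U"
    if Y: "topspace Y = Max_spec A" "\<And>a. a \<in> carrier A \<Longrightarrow> continuous_map Y T (ev F A a)"
      and "openin (gelfand_topology F T A) U"
  proof -
    have "generate_topology_on
        {{M \<in> Max_spec A. ev F A a M \<in> U} | a U. a \<in> carrier A \<and> openin T U} U"
      using that(3) by (simp add: gelfand_topology_def openin_topology_generated_by_iff)
    then show ?thesis
    proof induction
      case (UN K)
      then show ?case by (intro openin_Union)
    next
      case (Basis s)
      then show ?case using Y(2) unfolding continuous_map Y(1) by auto
    qed (simp_all add: openin_Int)
  qed
qed

end

theory Submission
  imports Defs "HOL-Algebra.Multiplicative_Group"
begin

text \<open>
  Write \<open>A\<close> for the algebra of continuous functions and \<open>M\<^sub>x\<close> for the ideal of the functions
  vanishing at \<open>x\<close>. Once every maximal ideal is known to be some \<open>M\<^sub>x\<close>, the evaluation of \<open>a\<close> at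
  \<open>M\<^sub>x\<close> is \<open>a x\<close>, and the two topologies are easily compared. The set \<open>D(a)\<close> is the preimage of
  the nonzero elements under the evaluation, and these form an open set. Conversely, if \<open>a x\<close> lies
  in the open set \<open>U\<close>, there is \<open>f\<close> with value one at \<open>x\<close> that vanishes where \<open>a\<close> is not in \<open>U\<close>,
  and \<open>D(f)\<close> is a Zariski neighbourhood of \<open>M\<^sub>x\<close> on which the evaluation of \<open>a\<close> lies in \<open>U\<close>.

  The substance is that an ideal \<open>I\<close> whose members have no common zero contains a unit
  (\<open>ideal_without_common_zero_eq_carrier\<close>). By compactness finitely many members of \<open>I\<close> have no
  common zero, and they have to be merged into one function without zeros. Over the reals one
  would take the sum of squares; over an arbitrary topological field two different reasons apply.

  If zero has no compact neighbourhood, constants suffice: for \<open>f\<close> and \<open>g\<close> without common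
  zero on a compact space some \<open>f - c g\<close> has no zero, since otherwise \<open>f / g\<close> would map a compact set onto a
  neighbourhood of zero (\<open>nonvanishing_combination\<close>).

  If zero has a compact neighbourhood, there are bump functions, equal to one near a given point
  and to zero outside a given neighbourhood (\<open>bump_function\<close>), and these yield a partition
  argument. They come from one of two sources (\<open>open_subgroup_or_path\<close>), which correspond to
  the nonarchimedean and the archimedean locally compact fields. In a discrete field
  \<open>{\<zero>}\<close> is an open subgroup that omits one. In a nondiscrete field in which the natural multiples
  of one are bounded, the topologically nilpotent elements form such a subgroup. Cosets of it are
  clopen. Otherwise some \<open>1 / n\<close> is topologically nilpotent, and base-\<open>n\<close>
  expansions of real numbers define a path from zero to one. Both sources rest on the same fact
  about Horner sums (\<open>compact_horner_invariant\<close>): for compact \<open>D\<close> and topologically nilpotent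
  \<open>x\<close> in a nondiscrete field, all sums of terms \<open>d\<^sub>i x\<^sup>i\<close> with \<open>d\<^sub>i \<in> D\<close> lie in a common compact set.
\<close>

section \<open>Topology of a topological field\<close>

context topological_field
begin

lemma continuous_map_minus:
  assumes "continuous_map S T f"
  shows "continuous_map S T (\<lambda>x. \<ominus> f x)"
proof (rule continuous_map_eq)
  show "continuous_map S T (\<lambda>x. (\<ominus> \<one>) \<otimes> f x)"
    using assms by (intro continuous_map_mult) (simp_all add: topspace_eq)
  show "(\<ominus> \<one>) \<otimes> f x = \<ominus> f x" if "x \<in> topspace S" for x
    using continuous_map_carrier[OF assms that] by (simp add: l_minus)
qed

lemma continuous_map_diff:
  "\<lbrakk>continuous_map S T f; continuous_map S T g\<rbrakk> \<Longrightarrow> continuous_map S T (\<lambda>x. f x \<ominus> g x)"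
  unfolding a_minus_def by (intro continuous_map_add continuous_map_minus)

lemma continuous_map_inv:
  assumes "continuous_map S T f" "\<And>x. x \<in> topspace S \<Longrightarrow> f x \<noteq> \<zero>"
  shows "continuous_map S T (\<lambda>x. inv (f x))"
proof -
  have "f \<in> topspace S \<rightarrow> carrier F - {\<zero>}"
    using assms(2) continuous_map_carrier[OF assms(1)] by auto
  then have "continuous_map S (subtopology T (carrier F - {\<zero>})) f"
    using assms(1) by (intro continuous_map_into_subtopology)
  from continuous_map_compose[OF this continuous_inv] show ?thesis
    by (simp add: o_def)
qed

lemma nhds_binary:
  assumes "continuous_map (prod_topology T T) T (\<lambda>(a, b). h a b)"
    and "openin T U" "a \<in> carrier F" "b \<in> carrier F" "h a b \<in> U"
  obtains V W where "openin T V" "openin T W" "a \<in> V" "b \<in> W"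
    "\<And>v w. \<lbrakk>v \<in> V; w \<in> W\<rbrakk> \<Longrightarrow> h v w \<in> U"
proof -
  let ?P = "{z \<in> topspace (prod_topology T T). (case z of (a, b) \<Rightarrow> h a b) \<in> U}"
  have "openin (prod_topology T T) ?P"
    by (rule openin_continuous_map_preimage[OF assms(1,2)])
  moreover have "(a, b) \<in> ?P"
    using assms(3-) by (simp add: topspace_eq)
  ultimately have "\<exists>V W. openin T V \<and> openin T W \<and> a \<in> V \<and> b \<in> W \<and> V \<times> W \<subseteq> ?P"
    by (simp only: openin_prod_topology_alt)
  then obtain V W where VW: "openin T V" "openin T W" "a \<in> V" "b \<in> W" "V \<times> W \<subseteq> ?P"
    by (elim exE conjE)
  have "h v w \<in> U" if "v \<in> V" "w \<in> W" for v w
    using subsetD[OF VW(5), of "(v, w)"] that by simp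
  with VW(1-4) show ?thesis by (rule that)
qed

lemmas nhds_add = nhds_binary[OF continuous_add]
lemmas nhds_mult = nhds_binary[OF continuous_mult]

text \<open>The affine maps act doubly transitively on \<^term>\<open>F\<close>, so one nontrivial open set
  separates every pair of points.\<close>

lemma openin_nonzero: "openin T (carrier F - {\<zero>})"
proof -
  obtain U where U: "openin T U" "U \<noteq> {}" "U \<noteq> carrier F"
    using not_indiscrete by blast
  then have sub: "U \<subseteq> carrier F"
    using openin_subset topspace_eq by metis
  obtain a b where ab: "a \<in> U" "b \<in> carrier F" "b \<notin> U"
    using U sub by blast
  have a: "a \<in> carrier F" using ab(1) sub by blast
  have "\<exists>V. openin T V \<and> x \<in> V \<and> V \<subseteq> carrier F - {\<zero>}" if x: "x \<in> carrier F" "x \<noteq> \<zero>" for x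
  proof -
    \<comment> \<open>The affine map taking \<open>x\<close> to \<open>a\<close> and \<open>\<zero>\<close> to \<open>b\<close>.\<close>
    define h where "h z = b \<oplus> (a \<ominus> b) \<otimes> (inv x \<otimes> z)" for z
    have ix: "inv x \<in> carrier F" "inv x \<otimes> x = \<one>"
      using x by (simp_all add: field_Units)
    have d: "a \<ominus> b \<in> carrier F" using a ab(2) by simp
    have "continuous_map T T (\<lambda>z. z)" by (simp add: continuous_map_id[unfolded id_def])
    then have "continuous_map T T h"
      unfolding h_def using ab(2) ix(1) d
      by (intro continuous_map_add continuous_map_mult) (simp_all add: topspace_eq)
    then have "openin T {z \<in> topspace T. h z \<in> U}"
      by (rule openin_continuous_map_preimage) (rule U(1))
    moreover have "h x = a"
      unfolding h_def using a ab(2) ix d by (simp add: a_minus_def a_lcomm r_neg)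
    moreover have "h \<zero> = b" unfolding h_def using ab(2) ix d by simp
    ultimately show ?thesis
      using x ab by (intro exI[of _ "{z \<in> topspace T. h z \<in> U}"]) (auto simp: topspace_eq)
  qed
  then show ?thesis by (subst openin_subopen) blast
qed

lemma openin_support:
  assumes "continuous_map S T f"
  shows "openin S {x \<in> topspace S. f x \<noteq> \<zero>}"
proof -
  have "{x \<in> topspace S. f x \<noteq> \<zero>} = {x \<in> topspace S. f x \<in> carrier F - {\<zero>}}"
    using continuous_map_carrier[OF assms] by auto
  then show ?thesis
    using openin_continuous_map_preimage[OF assms openin_nonzero] by simp
qed

lemma Hausdorff_space: "Hausdorff_space T"
  unfolding Hausdorff_space_def
proof (intro allI impI)
  fix x y assume xy: "x \<in> topspace T \<and> y \<in> topspace T \<and> x \<noteq> y"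
  let ?P = "{z \<in> topspace (prod_topology T T). fst z \<ominus> snd z \<noteq> \<zero>}"
  have "continuous_map (prod_topology T T) T (\<lambda>z. fst z \<ominus> snd z)"
    by (intro continuous_map_diff continuous_map_fst continuous_map_snd)
  then have "openin (prod_topology T T) ?P"
    by (rule openin_support)
  moreover have "(x, y) \<in> ?P"
    using xy by (simp add: topspace_eq)
  ultimately have "\<exists>U V. openin T U \<and> openin T V \<and> x \<in> U \<and> y \<in> V \<and> U \<times> V \<subseteq> ?P"
    by (simp only: openin_prod_topology_alt)
  then obtain U V where UV: "openin T U" "openin T V" "x \<in> U" "y \<in> V" "U \<times> V \<subseteq> ?P"
    by (elim exE conjE)
  have "z \<notin> V" if "z \<in> U" for z
    using subsetD[OF UV(5), of "(z, z)"] that by (auto simp: topspace_eq)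
  then have "disjnt U V" by (auto simp: disjnt_iff)
  with UV(1-4) show "\<exists>U V. openin T U \<and> openin T V \<and> x \<in> U \<and> y \<in> V \<and> disjnt U V"
    by (intro exI conjI)
qed

lemma tychonoff_over_imp_Hausdorff_space:
  assumes "tychonoff_over F T S"
  shows "Hausdorff_space S"
  unfolding Hausdorff_space_def
proof (intro allI impI)
  fix x y assume "x \<in> topspace S \<and> y \<in> topspace S \<and> x \<noteq> y"
  then have xy: "x \<in> topspace S" "y \<in> topspace S" "x \<noteq> y" by simp_all
  have "closedin S {y}"
    using assms xy by (simp add: tychonoff_over_def t1_space_closedin_singleton)
  then obtain f where f: "continuous_map S T f" "f x = \<one>" "f y = \<zero>"
    using assms xy unfolding tychonoff_over_def by blast
  obtain U V where UV: "openin T U" "openin T V" "\<one> \<in> U" "\<zero> \<in> V" "disjnt U V"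
    using Hausdorff_space one_not_zero one_closed zero_closed
    unfolding Hausdorff_space_def topspace_eq by blast
  have "openin S {z \<in> topspace S. f z \<in> U}" "openin S {z \<in> topspace S. f z \<in> V}"
    using openin_continuous_map_preimage[OF f(1)] UV by blast+
  then show "\<exists>U V. openin S U \<and> openin S V \<and> x \<in> U \<and> y \<in> V \<and> disjnt U V"
    using xy f UV by (intro exI[of _ "{z \<in> topspace S. f z \<in> U}"]
      exI[of _ "{z \<in> topspace S. f z \<in> V}"]) (auto simp: disjnt_iff)
qed

section \<open>Fields without a compact neighbourhood of zero\<close>

text \<open>If no \<open>c\<close> works, the quotient \<open>f / g\<close> takes every value in \<^term>\<open>F\<close>. The points where
  it takes values near zero lie outside the open set on which \<open>f\<close> is nonzero and \<open>g / f\<close> is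
  small. The complement of that set is compact and contains no zero of \<open>g\<close>. Its image under \<open>f / g\<close> is then a compact neighbourhood of zero.\<close>

lemma nonvanishing_combination:
  assumes "compact_space S" and f: "continuous_map S T f" and g: "continuous_map S T g"
    and no_common_zero: "\<And>y. y \<in> topspace S \<Longrightarrow> f y \<noteq> \<zero> \<or> g y \<noteq> \<zero>"
    and no_compact_nhd: "\<And>N B. \<lbrakk>openin T N; \<zero> \<in> N; compactin T B\<rbrakk> \<Longrightarrow> \<not> N \<subseteq> B"
  shows "\<exists>c\<in>carrier F. \<forall>y\<in>topspace S. f y \<noteq> c \<otimes> g y"
proof (rule ccontr)
  assume "\<not> ?thesis"
  then have all_values: "\<exists>y\<in>topspace S. f y = c \<otimes> g y" if "c \<in> carrier F" for c
    using that by blast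
  have "openin T (carrier F - {\<one>})"
    using openin_diff[OF openin_topspace closedin_Hausdorff_singleton[OF Hausdorff_space]] topspace_eq
    by (metis one_closed)
  then obtain N W where NW: "openin T N" "openin T W" "\<zero> \<in> N" "\<zero> \<in> W"
      "\<And>v w. \<lbrakk>v \<in> N; w \<in> W\<rbrakk> \<Longrightarrow> v \<otimes> w \<in> carrier F - {\<one>}"
    by (rule nhds_mult[of _ \<zero> \<zero>]) auto
  note carr = continuous_map_carrier[OF f] continuous_map_carrier[OF g]
  define V where "V = {y \<in> topspace S. f y \<noteq> \<zero>}"
  define O' where "O' = {y \<in> V. inv (f y) \<otimes> g y \<in> W}"
  define E where "E = topspace S - O'"
  have V: "openin S V" unfolding V_def by (rule openin_support[OF f])
  have "continuous_map (subtopology S V) T (\<lambda>y. inv (f y) \<otimes> g y)"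
    using f g by (intro continuous_map_mult continuous_map_inv continuous_map_from_subtopology)
      (auto simp: V_def)
  from openin_continuous_map_preimage[OF this NW(2)] have "openin (subtopology S V) O'"
    using openin_subset[OF V] by (simp add: O'_def Int_absorb1)
  then have "openin S O'" using V by (rule openin_trans_full)
  then have "compactin S E"
    unfolding E_def by (intro closedin_compact_space assms(1)) auto
  moreover have g_nonzero: "g y \<noteq> \<zero>" if "y \<in> E" for y
    using that no_common_zero[of y] NW(4) carr(1)[of y]
    by (auto simp: E_def O'_def V_def field_Units)
  ultimately have "compactin T ((\<lambda>y. f y \<otimes> inv (g y)) ` E)"
    using f g by (intro image_compactin[of "subtopology S E"] continuous_map_mult continuous_map_inv
        continuous_map_from_subtopology) (auto simp: compactin_subtopology)
  moreover have "N \<subseteq> (\<lambda>y. f y \<otimes> inv (g y)) ` E"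
  proof
    fix c assume c: "c \<in> N"
    then have cF: "c \<in> carrier F" using openin_subset[OF NW(1)] topspace_eq by auto
    then obtain y where y: "y \<in> topspace S" "f y = c \<otimes> g y"
      using all_values by blast
    have "y \<in> E"
    proof (rule ccontr)
      assume "y \<notin> E"
      then have o: "f y \<noteq> \<zero>" "inv (f y) \<otimes> g y \<in> W"
        using y(1) by (auto simp: E_def O'_def V_def)
      have i: "inv (f y) \<in> carrier F" "inv (f y) \<otimes> f y = \<one>"
        using o(1) carr(1)[OF y(1)] by (simp_all add: field_Units)
      have "c \<otimes> (inv (f y) \<otimes> g y) = inv (f y) \<otimes> (c \<otimes> g y)"
        using cF i(1) carr(2)[OF y(1)] by (simp add: m_lcomm)
      also have "\<dots> = \<one>" using i(2) y(2) by simp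
      finally show False using NW(5)[OF c o(2)] by simp
    qed
    moreover have "c = f y \<otimes> inv (g y)"
      using g_nonzero[OF \<open>y \<in> E\<close>] y cF carr(2)[OF y(1)]
      by (simp add: m_assoc field_Units)
    ultimately show "c \<in> (\<lambda>y. f y \<otimes> inv (g y)) ` E" by blast
  qed
  ultimately show False using no_compact_nhd NW(1,3) by blast
qed

end

section \<open>Compact sets and topologically nilpotent elements\<close>

context topological_field
begin

lemma openin_subset_carrier: "openin T U \<Longrightarrow> U \<subseteq> carrier F"
  using openin_subset topspace_eq by metis

lemma compactin_subset_carrier: "compactin T C \<Longrightarrow> C \<subseteq> carrier F"
  using compactin_subset_topspace topspace_eq by metis

lemma compactin_add:
  assumes "compactin T C" "compactin T D"
  shows "compactin T ((\<lambda>(a, b). a \<oplus> b) ` (C \<times> D))"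
  by (rule image_compactin[OF _ continuous_add]) (simp add: compactin_Times assms)

lemma continuous_map_scale: "c \<in> carrier F \<Longrightarrow> continuous_map T T (\<lambda>a. c \<otimes> a)"
  by (intro continuous_map_mult) (simp_all add: topspace_eq continuous_map_id[unfolded id_def])

lemma continuous_map_translate: "c \<in> carrier F \<Longrightarrow> continuous_map T T (\<lambda>a. c \<oplus> a)"
  by (intro continuous_map_add) (simp_all add: topspace_eq continuous_map_id[unfolded id_def])

lemma compactin_scale:
  "\<lbrakk>compactin T C; c \<in> carrier F\<rbrakk> \<Longrightarrow> compactin T ((\<lambda>a. c \<otimes> a) ` C)"
  by (rule image_compactin[OF _ continuous_map_scale])

lemma openin_scale:
  assumes "openin T U" "c \<in> carrier F" "c \<noteq> \<zero>"
  shows "openin T ((\<lambda>a. c \<otimes> a) ` U)"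
proof -
  have i: "inv c \<in> carrier F" "inv c \<otimes> c = \<one>" "c \<otimes> inv c = \<one>"
    using assms by (simp_all add: field_Units)
  have "(\<lambda>a. c \<otimes> a) ` U = {b \<in> topspace T. inv c \<otimes> b \<in> U}"
  proof (intro equalityI subsetI)
    fix b assume "b \<in> (\<lambda>a. c \<otimes> a) ` U"
    then obtain a where a: "a \<in> U" "b = c \<otimes> a" by blast
    then have "a \<in> carrier F" using openin_subset_carrier[OF assms(1)] by blast
    then show "b \<in> {b \<in> topspace T. inv c \<otimes> b \<in> U}"
      using a i assms(2) by (simp add: topspace_eq m_assoc[symmetric])
  next
    fix b assume "b \<in> {b \<in> topspace T. inv c \<otimes> b \<in> U}"
    then have b: "b \<in> carrier F" "inv c \<otimes> b \<in> U" by (simp_all add: topspace_eq)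
    have "b = c \<otimes> (inv c \<otimes> b)" using b(1) i assms(2) by (simp add: m_assoc[symmetric])
    then show "b \<in> (\<lambda>a. c \<otimes> a) ` U" using b(2) by blast
  qed
  then show ?thesis
    using openin_continuous_map_preimage[OF continuous_map_scale[OF i(1)] assms(1)] by simp
qed

text \<open>Compact sets are bounded in the sense of topological rings.\<close>

lemma compactin_absorbed:
  assumes "compactin T C" "openin T V" "\<zero> \<in> V"
  obtains W where "openin T W" "\<zero> \<in> W" "\<And>w c. \<lbrakk>w \<in> W; c \<in> C\<rbrakk> \<Longrightarrow> w \<otimes> c \<in> V"
proof -
  let ?P = "{z \<in> topspace (prod_topology T T). (case z of (a, b) \<Rightarrow> a \<otimes> b) \<in> V}"
  have P: "openin (prod_topology T T) ?P"
    by (rule openin_continuous_map_preimage[OF continuous_mult assms(2)])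
  have sub: "{\<zero>} \<times> C \<subseteq> ?P"
    using compactin_subset_carrier[OF assms(1)] assms(3) by (auto simp: topspace_eq)
  have "compactin T {\<zero>}" by (simp add: topspace_eq)
  from Wallace_theorem_prod_topology[OF this assms(1) P sub]
  obtain W W' where W: "openin T W" "{\<zero>} \<subseteq> W" "C \<subseteq> W'" "W \<times> W' \<subseteq> ?P" .
  have "w \<otimes> c \<in> V" if "w \<in> W" "c \<in> C" for w c
    using subsetD[OF W(4), of "(w, c)"] that W(3) by auto
  then show ?thesis using that[of W] W by simp
qed

definition top_nilpotent :: "'f \<Rightarrow> bool" where
  "top_nilpotent x \<longleftrightarrow> x \<in> carrier F \<and> limitin T (\<lambda>n. x [^] (n::nat)) \<zero> sequentially"

lemma top_nilpotent_carrier: "top_nilpotent x \<Longrightarrow> x \<in> carrier F"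
  by (simp add: top_nilpotent_def)

lemma top_nilpotentI:
  "\<lbrakk>x \<in> carrier F; \<And>U. \<lbrakk>openin T U; \<zero> \<in> U\<rbrakk> \<Longrightarrow> \<exists>m. \<forall>n\<ge>m. x [^] (n::nat) \<in> U\<rbrakk> \<Longrightarrow> top_nilpotent x"
  by (simp add: top_nilpotent_def limitin_sequentially topspace_eq)

lemma top_nilpotent_absorbs:
  assumes "top_nilpotent x" "compactin T C" "openin T V" "\<zero> \<in> V"
  obtains m :: nat where "\<And>n c. \<lbrakk>m \<le> n; c \<in> C\<rbrakk> \<Longrightarrow> x [^] n \<otimes> c \<in> V"
proof -
  obtain W where W: "openin T W" "\<zero> \<in> W" "\<And>w c. \<lbrakk>w \<in> W; c \<in> C\<rbrakk> \<Longrightarrow> w \<otimes> c \<in> V"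
    by (rule compactin_absorbed[OF assms(2-4)]) blast
  have "\<exists>m. \<forall>n. m \<le> n \<longrightarrow> x [^] (n::nat) \<in> W"
    using assms(1) W(1,2) by (simp add: top_nilpotent_def limitin_sequentially)
  then obtain m where m: "\<forall>n. m \<le> n \<longrightarrow> x [^] (n::nat) \<in> W" ..
  show ?thesis by (rule that[of m]) (use m W(3) in simp)
qed

lemma top_nilpotent_zero: "top_nilpotent \<zero>"
proof (rule top_nilpotentI)
  fix U assume "openin T U" "\<zero> \<in> U"
  then show "\<exists>m. \<forall>n\<ge>m. \<zero> [^] (n::nat) \<in> U"
    by (intro exI[of _ 1]) (auto simp: nat_pow_zero)
qed simp

lemma not_top_nilpotent_one: "\<not> top_nilpotent \<one>"
proof
  assume "top_nilpotent \<one>"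
  then have "limitin T (\<lambda>n::nat. \<one>) \<zero> sequentially" by (simp add: top_nilpotent_def)
  moreover have "limitin T (\<lambda>n::nat. \<one>) \<one> sequentially"
    by (simp add: topspace_eq)
  ultimately show False
    using limitin_Hausdorff_unique[OF _ _ _ Hausdorff_space] by fastforce
qed

text \<open>The only cluster point of the powers of \<open>w\<close> is zero: if \<open>w [^] m\<close> and \<open>w [^] n\<close> with
  \<open>m < n\<close> were both close to some \<open>c \<noteq> \<zero>\<close>, then \<open>w [^] (n - m)\<close> would be close to one.\<close>

lemma top_nilpotent_if_powers_avoid_one:
  assumes B: "compactin T B" and w: "w \<in> carrier F"
    and powers_in: "\<And>n. 0 < n \<Longrightarrow> w [^] (n::nat) \<in> B"
    and Q: "openin T Q" "\<one> \<in> Q" and powers_avoid: "\<And>n. 0 < n \<Longrightarrow> w [^] (n::nat) \<notin> Q"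
  shows "top_nilpotent w"
proof (rule top_nilpotentI[OF w])
  fix U assume U: "openin T U" "\<zero> \<in> U"
  define F' where "F' = subtopology T (carrier F - {\<zero>})"
  have once: "\<exists>R. openin T R \<and> c \<in> R \<and> finite {n. 0 < n \<and> w [^] (n::nat) \<in> R}"
    if c: "c \<in> B - U" for c
  proof -
    have c0: "c \<in> carrier F" "c \<noteq> \<zero>"
      using c U(2) compactin_subset_carrier[OF B] by auto
    let ?P = "{z \<in> topspace (prod_topology F' F'). fst z \<otimes> inv (snd z) \<in> Q}"
    have proj: "continuous_map (prod_topology F' F') T fst" "continuous_map (prod_topology F' F') T snd"
      using continuous_map_fst[of F' F'] continuous_map_snd[of F' F']
      unfolding F'_def by (blast intro: continuous_map_into_fulltopology)+
    have "snd z \<noteq> \<zero>" if "z \<in> topspace (prod_topology F' F')" for z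
      using that unfolding F'_def by auto
    from continuous_map_mult[OF proj(1) continuous_map_inv[OF proj(2) this]]
    have "continuous_map (prod_topology F' F') T (\<lambda>z. fst z \<otimes> inv (snd z))" .
    then have "openin (prod_topology F' F') ?P"
      by (rule openin_continuous_map_preimage) (rule Q(1))
    moreover have "(c, c) \<in> ?P"
      using c0 Q(2) by (simp add: F'_def topspace_eq field_Units)
    ultimately have "\<exists>V W. openin F' V \<and> openin F' W \<and> c \<in> V \<and> c \<in> W \<and> V \<times> W \<subseteq> ?P"
      by (simp only: openin_prod_topology_alt)
    then obtain V W where VW: "openin F' V" "openin F' W" "c \<in> V" "c \<in> W" "V \<times> W \<subseteq> ?P"
      by (elim exE conjE)
    have R: "openin T (V \<inter> W)"
      by (rule openin_Int[OF openin_trans_full[OF VW(1)[unfolded F'_def] openin_nonzero]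
            openin_trans_full[OF VW(2)[unfolded F'_def] openin_nonzero]])
    have no_two: False if "0 < m" "m < n" "w [^] m \<in> V \<inter> W" "w [^] n \<in> V \<inter> W" for m n :: nat
    proof -
      have "w [^] m \<noteq> \<zero>"
        using that(3) openin_subset[OF VW(1)] by (auto simp: F'_def)
      then have i: "inv (w [^] m) \<in> carrier F" "w [^] m \<otimes> inv (w [^] m) = \<one>"
        using w by (simp_all add: field_Units)
      have "w [^] n \<otimes> inv (w [^] m) \<in> Q"
        using subsetD[OF VW(5), of "(w [^] n, w [^] m)"] that by auto
      moreover have "w [^] n = w [^] (n - m) \<otimes> w [^] m"
        using that w by (simp add: nat_pow_mult)
      then have "w [^] n \<otimes> inv (w [^] m) = w [^] (n - m)"
        using w i by (simp add: m_assoc)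
      ultimately show False using powers_avoid[of "n - m"] that by simp
    qed
    have "finite {n. 0 < n \<and> w [^] (n::nat) \<in> V \<inter> W}"
    proof (cases "\<exists>m. 0 < m \<and> w [^] (m::nat) \<in> V \<inter> W")
      case True
      then obtain m :: nat where m: "0 < m" "w [^] m \<in> V \<inter> W" by blast
      have "n = m" if "0 < n" "w [^] n \<in> V \<inter> W" for n :: nat
        using no_two[of m n] no_two[of n m] m that by (cases n m rule: linorder_cases) simp_all
      then have "{n. 0 < n \<and> w [^] (n::nat) \<in> V \<inter> W} \<subseteq> {m}"
        by blast
      then show ?thesis by (rule finite_subset) simp
    next
      case False
      then have "{n. 0 < n \<and> w [^] (n::nat) \<in> V \<inter> W} = {}" by blast
      then show ?thesis by (simp only: finite.emptyI)
    qed
    then show ?thesis using R VW(3,4) by blast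
  qed
  then have "\<forall>c\<in>B - U. \<exists>R. openin T R \<and> c \<in> R \<and> finite {n. 0 < n \<and> w [^] (n::nat) \<in> R}"
    by blast
  from bchoice[OF this] obtain R where
    R: "\<forall>c\<in>B - U. openin T (R c) \<and> c \<in> R c \<and> finite {n. 0 < n \<and> w [^] (n::nat) \<in> R c}" ..
  have "closedin T (topspace T - U)" using U(1) by blast
  then have "compactin T (B \<inter> (topspace T - U))"
    by (rule compact_Int_closedin[OF B])
  moreover have "B \<inter> (topspace T - U) = B - U"
    using compactin_subset_topspace[OF B] by blast
  ultimately have "compactin T (B - U)" by simp
  moreover have "\<And>V. V \<in> R ` (B - U) \<Longrightarrow> openin T V" "B - U \<subseteq> \<Union> (R ` (B - U))"
    using R by auto
  ultimately have "\<exists>\<V>. finite \<V> \<and> \<V> \<subseteq> R ` (B - U) \<and> B - U \<subseteq> \<Union>\<V>"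
    unfolding compactin_def by simp
  then obtain \<V> where "finite \<V>" "\<V> \<subseteq> R ` (B - U)" "B - U \<subseteq> \<Union>\<V>"
    by (elim exE conjE)
  then obtain D where D: "D \<subseteq> B - U" "finite D" "B - U \<subseteq> \<Union> (R ` D)"
    by (metis finite_subset_image)
  have "finite (\<Union>c\<in>D. {n. 0 < n \<and> w [^] (n::nat) \<in> R c})"
    by (rule finite_UN_I[OF D(2)]) (use D(1) R in blast)
  moreover have "{n. 0 < n \<and> w [^] (n::nat) \<notin> U} \<subseteq> (\<Union>c\<in>D. {n. 0 < n \<and> w [^] n \<in> R c})"
    using D(3) powers_in by blast
  ultimately have "finite {n. 0 < n \<and> w [^] (n::nat) \<notin> U}"
    by (rule finite_subset[rotated])
  then obtain k where k: "{n. 0 < n \<and> w [^] (n::nat) \<notin> U} \<subseteq> {..k}"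
    using finite_nat_iff_bounded_le by blast
  have "w [^] n \<in> U" if "Suc k \<le> n" for n :: nat
  proof (rule ccontr)
    assume "w [^] n \<notin> U"
    then have "n \<in> {..k}" using that by (intro subsetD[OF k]) simp
    then show False using that by simp
  qed
  then show "\<exists>m. \<forall>n\<ge>m. w [^] (n::nat) \<in> U"
    by blast
qed

end

text \<open>Translations make a compact neighbourhood of zero as good as local compactness.\<close>

locale locally_compact_field = topological_field +
  fixes N B
  assumes openin_N: "openin T N" and zero_in_N: "\<zero> \<in> N"
    and compactin_B: "compactin T B" and N_subset_B: "N \<subseteq> B"
begin

lemma B_carrier: "b \<in> B \<Longrightarrow> b \<in> carrier F"
  using compactin_subset_carrier[OF compactin_B] by blast

lemma zero_in_B: "\<zero> \<in> B"
  using zero_in_N N_subset_B by blast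

text \<open>A neighbourhood \<open>V\<close> of zero inside \<^term>\<open>B\<close> that stays away from one is mapped into
  itself by all sufficiently small multipliers, so the powers of these remain in \<open>V\<close>.\<close>

lemma nhd_of_top_nilpotents:
  obtains W where "openin T W" "\<zero> \<in> W" "\<And>w. w \<in> W \<Longrightarrow> top_nilpotent w"
proof -
  have "\<zero> \<in> topspace T \<and> \<one> \<in> topspace T \<and> \<zero> \<noteq> \<one>"
    by (simp add: topspace_eq)
  then obtain V Q where VQ: "openin T V" "openin T Q" "\<zero> \<in> V" "\<one> \<in> Q" "disjnt V Q"
    using Hausdorff_space unfolding Hausdorff_space_def by meson
  define V' where "V' = N \<inter> V"
  have V': "openin T V'" "\<zero> \<in> V'"
    using openin_N zero_in_N VQ by (auto simp: V'_def)
  obtain W where W: "openin T W" "\<zero> \<in> W" "\<And>w c. \<lbrakk>w \<in> W; c \<in> B\<rbrakk> \<Longrightarrow> w \<otimes> c \<in> V'"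
    by (rule compactin_absorbed[OF compactin_B V']) blast
  have "top_nilpotent w" if w: "w \<in> W \<inter> V'" for w
  proof -
    have wF: "w \<in> carrier F" using w openin_subset_carrier[OF W(1)] by blast
    have pow: "w [^] Suc n \<in> V'" for n
    proof (induction n)
      case 0
      then show ?case using w wF by simp
    next
      case (Suc n)
      then have "w \<otimes> w [^] Suc n \<in> V'"
        using W(3) w N_subset_B by (auto simp: V'_def)
      then show ?case using wF nat_pow_Suc2[OF wF, of "Suc n"] by simp
    qed
    have pow': "w [^] n \<in> V'" if "0 < n" for n :: nat
      using pow[of "n - 1"] that by simp
    show ?thesis
    proof (rule top_nilpotent_if_powers_avoid_one[OF compactin_B wF _ VQ(2,4)])
      fix n :: nat assume "0 < n"
      then show "w [^] n \<in> B" "w [^] n \<notin> Q"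
        using pow'[of n] N_subset_B VQ(5) by (auto simp: V'_def disjnt_iff)
    qed
  qed
  then show ?thesis
    using that[of "W \<inter> V'"] W(1,2) V' by blast
qed

end

section \<open>Horner sums\<close>

context topological_field
begin

text \<open>The values at \<open>x\<close> of the polynomials with coefficients in \<open>D\<close>, in Horner form. Any set
  \<open>K\<close> that contains zero and satisfies \<open>D + x K \<subseteq> K\<close> contains all of them, however large their
  degree.\<close>

inductive_set horner_sums :: "'f set \<Rightarrow> 'f \<Rightarrow> 'f set" for D x where
  zero: "\<zero> \<in> horner_sums D x"
| step: "\<lbrakk>d \<in> D; p \<in> horner_sums D x\<rbrakk> \<Longrightarrow> d \<oplus> x \<otimes> p \<in> horner_sums D x"

lemma horner_sums_subset:
  assumes "\<zero> \<in> K" "\<And>d k. \<lbrakk>d \<in> D; k \<in> K\<rbrakk> \<Longrightarrow> d \<oplus> x \<otimes> k \<in> K"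
  shows "horner_sums D x \<subseteq> K"
proof
  fix p assume "p \<in> horner_sums D x"
  then show "p \<in> K" by induction (use assms in auto)
qed

lemma horner_sums_carrier:
  "\<lbrakk>D \<subseteq> carrier F; x \<in> carrier F\<rbrakk> \<Longrightarrow> horner_sums D x \<subseteq> carrier F"
  by (rule horner_sums_subset) auto

lemma horner_sums_add:
  assumes "D \<subseteq> carrier F" "x \<in> carrier F" "\<And>d e. \<lbrakk>d \<in> D; e \<in> D\<rbrakk> \<Longrightarrow> d \<oplus> e \<in> D"
    and "p \<in> horner_sums D x" "q \<in> horner_sums D x"
  shows "p \<oplus> q \<in> horner_sums D x"
  using assms(4,5)
proof (induction arbitrary: q)
  case zero
  then show ?case using horner_sums_carrier[OF assms(1,2)] by auto
next
  case (step d p)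
  have pF: "p \<in> carrier F" "d \<in> carrier F"
    using step.hyps horner_sums_carrier[OF assms(1,2)] assms(1) by auto
  from step.prems show ?case
  proof cases
    case zero
    then show ?thesis using horner_sums.step[OF step.hyps] pF assms(2) by simp
  next
    case (step e r)
    then have "r \<in> carrier F" "e \<in> carrier F"
      using horner_sums_carrier[OF assms(1,2)] assms(1) by auto
    then have "d \<oplus> x \<otimes> p \<oplus> q = (d \<oplus> e) \<oplus> x \<otimes> (p \<oplus> r)"
      using pF assms(2) step by (simp add: r_distr a_ac)
    then show ?thesis
      using horner_sums.step[OF assms(3)[OF \<open>d \<in> D\<close> step(2)] step.IH[OF step(3)]] by simp
  qed
qed

lemma horner_sums_mult:
  assumes "D \<subseteq> carrier F" "x \<in> carrier F" "z \<in> carrier F" "\<And>d. d \<in> D \<Longrightarrow> z \<otimes> d \<in> D"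
    and "p \<in> horner_sums D x"
  shows "z \<otimes> p \<in> horner_sums D x"
  using assms(5)
proof induction
  case zero
  then show ?case using horner_sums.zero assms(3) by simp
next
  case (step d p)
  have "p \<in> carrier F" "d \<in> carrier F"
    using step.hyps horner_sums_carrier[OF assms(1,2)] assms(1) by auto
  then have "z \<otimes> (d \<oplus> x \<otimes> p) = z \<otimes> d \<oplus> x \<otimes> (z \<otimes> p)"
    using assms(2,3) by (simp add: r_distr m_lcomm)
  then show ?case using horner_sums.step[OF assms(4)[OF step.hyps(1)] step.IH] by simp
qed

lemma horner_sums_mult_point:
  assumes "D \<subseteq> carrier F" "x \<in> carrier F" "\<zero> \<in> D" "p \<in> horner_sums D x"
  shows "x \<otimes> p \<in> horner_sums D x"
  using horner_sums.step[OF assms(3,4)] horner_sums_carrier[OF assms(1,2)] assms(2,4) by auto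

lemma subset_horner_sums:
  assumes "D \<subseteq> carrier F" "x \<in> carrier F" "d \<in> D"
  shows "d \<in> horner_sums D x"
proof -
  have "d \<oplus> x \<otimes> \<zero> = d" using assms by auto
  then show ?thesis using horner_sums.step[OF assms(3) horner_sums.zero, of x] by simp
qed

text \<open>Expand the power one factor at a time, spending the factors \<open>x\<close> on \<open>a\<close> and the factors
  \<open>y\<close> on \<open>b\<close> until one of the two is used up; no binomial coefficients have to be estimated.\<close>

lemma add_pow_split:
  assumes xy: "x \<in> carrier F" "y \<in> carrier F" and R: "R \<subseteq> carrier F" "\<zero> \<in> R" "\<one> \<in> R"
    and add: "\<And>r s. \<lbrakk>r \<in> R; s \<in> R\<rbrakk> \<Longrightarrow> r \<oplus> s \<in> R"
    and mult: "\<And>r. r \<in> R \<Longrightarrow> x \<otimes> r \<in> R" "\<And>r. r \<in> R \<Longrightarrow> y \<otimes> r \<in> R"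
  shows "\<exists>r\<in>R. \<exists>s\<in>R. (x \<oplus> y) [^] (a + b) = x [^] (a::nat) \<otimes> r \<oplus> y [^] (b::nat) \<otimes> s"
proof -
  have pow: "(x \<oplus> y) [^] (n::nat) \<in> R" for n
  proof (induction n)
    case (Suc n)
    have "(x \<oplus> y) [^] Suc n = x \<otimes> (x \<oplus> y) [^] n \<oplus> y \<otimes> (x \<oplus> y) [^] n"
      using xy by (simp only: nat_pow_Suc2 a_closed l_distr nat_pow_closed)
    then show ?case using add mult Suc by simp
  qed (use R in simp)
  show ?thesis
  proof (induction a arbitrary: b)
    case 0
    show ?case
      using pow[of b] R xy by (intro bexI[of _ "(x \<oplus> y) [^] b"] bexI[of _ \<zero>]) auto
  next
    case (Suc a)
    note outer = Suc.IH
    show ?case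
    proof (induction b)
      case 0
      show ?case
        using pow[of "Suc a"] R xy
        by (intro bexI[of _ \<zero>] bexI[of _ "(x \<oplus> y) [^] Suc a"]) (auto simp del: nat_pow_Suc)
    next
      case (Suc b)
      obtain r s where rs: "r \<in> R" "s \<in> R"
        "(x \<oplus> y) [^] (a + Suc b) = x [^] a \<otimes> r \<oplus> y [^] Suc b \<otimes> s"
        using outer[of "Suc b"] by blast
      obtain r' s' where rs': "r' \<in> R" "s' \<in> R"
        "(x \<oplus> y) [^] (Suc a + b) = x [^] Suc a \<otimes> r' \<oplus> y [^] b \<otimes> s'"
        using Suc.IH by blast
      have c: "r \<in> carrier F" "s \<in> carrier F" "r' \<in> carrier F" "s' \<in> carrier F"
        "x [^] a \<in> carrier F" "y [^] b \<in> carrier F"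
        using rs rs' R(1) xy by auto
      have "(x \<oplus> y) [^] (Suc a + Suc b) = (x \<oplus> y) \<otimes> (x \<oplus> y) [^] (a + Suc b)"
        using xy nat_pow_Suc2[of "x \<oplus> y" "a + Suc b"] by simp
      also have "\<dots> = x \<otimes> (x \<oplus> y) [^] (a + Suc b) \<oplus> y \<otimes> (x \<oplus> y) [^] (Suc a + b)"
        using xy by (simp add: l_distr del: nat_pow_Suc)
      also have "\<dots> = x \<otimes> (x [^] a \<otimes> r \<oplus> y [^] Suc b \<otimes> s) \<oplus> y \<otimes> (x [^] Suc a \<otimes> r' \<oplus> y [^] b \<otimes> s')"
        by (simp only: rs(3) rs'(3))
      also have "\<dots> = x [^] Suc a \<otimes> (r \<oplus> y \<otimes> r') \<oplus> y [^] Suc b \<otimes> (x \<otimes> s \<oplus> s')"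
        using xy c by (simp add: r_distr m_ac a_ac)
      finally have "(x \<oplus> y) [^] (Suc a + Suc b)
          = x [^] Suc a \<otimes> (r \<oplus> y \<otimes> r') \<oplus> y [^] Suc b \<otimes> (x \<otimes> s \<oplus> s')" .
      moreover have "r \<oplus> y \<otimes> r' \<in> R" "x \<otimes> s \<oplus> s' \<in> R"
        using rs rs' add mult by simp_all
      ultimately show ?case by blast
    qed
  qed
qed

lemma top_nilpotent_minus:
  assumes "top_nilpotent x"
  shows "top_nilpotent (\<ominus> x)"
proof (rule top_nilpotentI)
  have x: "x \<in> carrier F" using assms by (rule top_nilpotent_carrier)
  then show "\<ominus> x \<in> carrier F" by simp
  have sign: "(\<ominus> x) [^] n \<in> (\<lambda>c. x [^] n \<otimes> c) ` {\<one>, \<ominus> \<one>}" for n :: nat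
  proof (induction n)
    case (Suc n)
    then obtain c where "c = \<one> \<or> c = \<ominus> \<one>" "(\<ominus> x) [^] n = x [^] n \<otimes> c" by auto
    then show ?case using x by (auto simp: r_minus l_minus)
  qed simp
  fix U assume U: "openin T U" "\<zero> \<in> U"
  have "compactin T {\<one>, \<ominus> \<one>}"
    by (rule finite_imp_compactin) (simp_all add: topspace_eq)
  then obtain m where m: "\<And>n c. \<lbrakk>m \<le> n; c \<in> {\<one>, \<ominus> \<one>}\<rbrakk> \<Longrightarrow> x [^] (n::nat) \<otimes> c \<in> U"
    by (rule top_nilpotent_absorbs[OF assms _ U]) blast
  have "(\<ominus> x) [^] n \<in> U" if "m \<le> n" for n :: nat
    using sign[of n] m[OF that] by auto
  then show "\<exists>m. \<forall>n\<ge>m. (\<ominus> x) [^] (n::nat) \<in> U" by blast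
qed

lemma nonzero_in_nhd:
  assumes "\<not> openin T {\<zero>}" "openin T U" "\<zero> \<in> U"
  obtains w where "w \<in> U" "w \<in> carrier F" "w \<noteq> \<zero>"
proof -
  have "U \<noteq> {\<zero>}" using assms by auto
  then show ?thesis
    using that openin_subset_carrier[OF assms(2)] assms(3) by blast
qed

end

context locally_compact_field
begin

text \<open>A power \<open>x [^] m\<close> contracts \<open>B + B\<close> into \<open>B\<close>. Dilating \<^term>\<open>B\<close> by a large scalar \<open>l\<close>
  keeps this property and makes room for the block \<open>D + x D + \<dots> + x [^] (m - 1) D\<close>, so that
  the \<open>m\<close>-th iterate of the Horner step maps \<open>C = l (B + B)\<close> into itself. The union of the first
  \<open>m\<close> iterates is then invariant under a single step.\<close>

lemma compact_horner_invariant: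
  assumes nondiscrete: "\<not> openin T {\<zero>}" and D: "compactin T D" and x: "top_nilpotent x"
  obtains K where "compactin T K" "\<zero> \<in> K" "\<And>d k. \<lbrakk>d \<in> D; k \<in> K\<rbrakk> \<Longrightarrow> d \<oplus> x \<otimes> k \<in> K"
proof -
  have xF: "x \<in> carrier F" using x by (rule top_nilpotent_carrier)
  have DF: "D \<subseteq> carrier F" using D by (rule compactin_subset_carrier)
  define step where "step K = (\<lambda>(a, b). a \<oplus> b) ` (D \<times> (\<lambda>k. x \<otimes> k) ` K)" for K
  have stepI: "d \<oplus> x \<otimes> k \<in> step K" if "d \<in> D" "k \<in> K" for d k K
    unfolding step_def using that by auto
  have stepE: "\<exists>d\<in>D. \<exists>k\<in>K. z = d \<oplus> x \<otimes> k" if "z \<in> step K" for z K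
    using that unfolding step_def by auto
  have compact_iterate: "compactin T ((step ^^ i) K)" if "compactin T K" for i K
  proof (induction i)
    case (Suc i)
    then show ?case
      using compactin_add[OF D compactin_scale[OF Suc xF]] by (simp add: step_def)
  qed (use that in simp)
  define C\<^sub>0 where "C\<^sub>0 = (\<lambda>(a, b). a \<oplus> b) ` (B \<times> B)"
  have C\<^sub>0: "compactin T C\<^sub>0"
    unfolding C\<^sub>0_def by (rule compactin_add[OF compactin_B compactin_B])
  obtain m' where m': "\<And>n c. \<lbrakk>m' \<le> n; c \<in> C\<^sub>0\<rbrakk> \<Longrightarrow> x [^] (n::nat) \<otimes> c \<in> N"
    by (rule top_nilpotent_absorbs[OF x C\<^sub>0 openin_N zero_in_N]) blast
  \<comment> \<open>At least one iterate is needed for the union below to contain \<open>C\<close>.\<close>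
  define m where "m = Suc m'"
  define E where "E i = (step ^^ i) {\<zero>}" for i
  have E: "compactin T (E i)" for i
    unfolding E_def by (rule compact_iterate) (simp add: topspace_eq)
  have EF: "E i \<subseteq> carrier F" for i using E by (rule compactin_subset_carrier)
  \<comment> \<open>\<open>E i\<close> is \<open>D + x D + \<dots> + x [^] (i - 1) D\<close>, and the \<open>i\<close>-th iterate of \<open>K\<close> is \<open>E i + x [^] i K\<close>.\<close>
  have split: "\<exists>e\<in>E i. \<exists>k\<in>K. z = e \<oplus> x [^] i \<otimes> k"
    if "K \<subseteq> carrier F" "z \<in> (step ^^ i) K" for i z K
    using that(2)
  proof (induction i arbitrary: z)
    case 0
    then have "z = \<zero> \<oplus> x [^] (0::nat) \<otimes> z" using that(1) by auto
    then show ?case using 0 by (auto simp: E_def)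
  next
    case (Suc i)
    have "z \<in> step ((step ^^ i) K)" using Suc.prems by simp
    then obtain d z' where d: "d \<in> D" "z' \<in> (step ^^ i) K" "z = d \<oplus> x \<otimes> z'"
      using stepE by blast
    obtain e k where e: "e \<in> E i" "k \<in> K" "z' = e \<oplus> x [^] i \<otimes> k"
      using Suc.IH[OF d(2)] by blast
    have "e \<in> carrier F" "k \<in> carrier F" "d \<in> carrier F"
      using EF[of i] e(1,2) that(1) d(1) DF by auto
    then have "z = (d \<oplus> x \<otimes> e) \<oplus> x [^] Suc i \<otimes> k"
      using xF by (simp add: d(3) e(3) r_distr m_ac a_ac)
    moreover have "d \<oplus> x \<otimes> e \<in> E (Suc i)"
      using stepI[OF d(1) e(1)] by (simp add: E_def)
    ultimately show ?case using e(2) by blast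
  qed
  obtain W where W: "openin T W" "\<zero> \<in> W" "\<And>w e. \<lbrakk>w \<in> W; e \<in> E m\<rbrakk> \<Longrightarrow> w \<otimes> e \<in> N"
    by (rule compactin_absorbed[OF E openin_N zero_in_N]) blast
  obtain w where w: "w \<in> W" "w \<in> carrier F" "w \<noteq> \<zero>"
    by (rule nonzero_in_nhd[OF nondiscrete W(1,2)])
  define l where "l = inv w"
  have l: "l \<in> carrier F" "l \<otimes> w = \<one>"
    using w(2,3) by (simp_all add: l_def field_Units)
  define C where "C = (\<lambda>a. l \<otimes> a) ` C\<^sub>0"
  have C: "compactin T C" unfolding C_def by (rule compactin_scale[OF C\<^sub>0 l(1)])
  have C\<^sub>0F: "C\<^sub>0 \<subseteq> carrier F" and CF: "C \<subseteq> carrier F"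
    using C\<^sub>0 C by (simp_all add: compactin_subset_carrier)
  have "\<zero> \<oplus> \<zero> \<in> C\<^sub>0" unfolding C\<^sub>0_def using zero_in_B by force
  then have zero_C: "\<zero> \<in> C" unfolding C_def using l by force
  have iterate_m: "(step ^^ m) C \<subseteq> C"
  proof
    fix z assume "z \<in> (step ^^ m) C"
    then obtain e k where e: "e \<in> E m" "k \<in> C" "z = e \<oplus> x [^] m \<otimes> k"
      using split[OF CF] by blast
    then obtain c where c: "c \<in> C\<^sub>0" "k = l \<otimes> c" unfolding C_def by blast
    have F: "e \<in> carrier F" "c \<in> carrier F" using EF e(1) C\<^sub>0F c(1) by auto
    have "w \<otimes> e \<in> B" "x [^] m \<otimes> c \<in> B"
      using W(3)[OF w(1) e(1)] m'[OF _ c(1), of m] N_subset_B by (auto simp: m_def)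
    then have "w \<otimes> e \<oplus> x [^] m \<otimes> c \<in> C\<^sub>0" unfolding C\<^sub>0_def by auto
    moreover have "l \<otimes> (w \<otimes> e) = e" using F l w by (simp add: m_assoc[symmetric])
    then have "z = l \<otimes> (w \<otimes> e \<oplus> x [^] m \<otimes> c)"
      using F l w xF by (simp add: e(3) c(2) r_distr m_lcomm)
    ultimately show "z \<in> C" unfolding C_def by blast
  qed
  define K where "K = (\<Union>i\<in>{..<m}. (step ^^ i) C)"
  have "compactin T K"
    unfolding K_def using compact_iterate[OF C] by (intro compactin_Union) auto
  moreover have "\<zero> \<in> K"
    unfolding K_def using zero_C by (intro UN_I[of 0]) (auto simp: m_def)
  moreover have "d \<oplus> x \<otimes> k \<in> K" if d: "d \<in> D" and "k \<in> K" for d k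
  proof -
    obtain i where i: "i < m" "k \<in> (step ^^ i) C"
      using \<open>k \<in> K\<close> unfolding K_def by blast
    have next_iterate: "d \<oplus> x \<otimes> k \<in> (step ^^ Suc i) C"
      using stepI[OF d i(2)] by simp
    show ?thesis
    proof (cases "Suc i < m")
      case True
      then show ?thesis unfolding K_def using next_iterate by blast
    next
      case False
      then have "Suc i = m" using i(1) by simp
      then have "d \<oplus> x \<otimes> k \<in> (step ^^ 0) C" using next_iterate iterate_m by auto
      then show ?thesis unfolding K_def by (intro UN_I[of 0]) (auto simp: m_def)
    qed
  qed
  ultimately show ?thesis by (rule that)
qed

end

section \<open>Bounded prime ring: an open subgroup\<close>

context locally_compact_field
begin

text \<open>Two Horner steps show that the semiring \<open>R\<close> of all polynomial expressions in \<open>x\<close> and \<open>y\<close>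
  with natural coefficients is bounded. Every high power of \<open>x \<oplus> y\<close> lies in
  \<open>x [^] a R + y [^] b R\<close> with \<open>a\<close> and \<open>b\<close> large, hence is small.\<close>

lemma top_nilpotent_add:
  assumes nondiscrete: "\<not> openin T {\<zero>}"
    and K\<^sub>0: "compactin T K\<^sub>0" "\<And>n::nat. [n] \<cdot> \<one> \<in> K\<^sub>0"
    and x: "top_nilpotent x" and y: "top_nilpotent y"
  shows "top_nilpotent (x \<oplus> y)"
proof -
  have F: "x \<in> carrier F" "y \<in> carrier F" using x y by (simp_all add: top_nilpotent_carrier)
  define M where "M = range (\<lambda>n::nat. [n] \<cdot> \<one>)"
  define R\<^sub>x where "R\<^sub>x = horner_sums M x"
  define R where "R = horner_sums R\<^sub>x y"
  have MF: "M \<subseteq> carrier F" unfolding M_def by auto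
  have RxF: "R\<^sub>x \<subseteq> carrier F" unfolding R\<^sub>x_def by (rule horner_sums_carrier[OF MF F(1)])
  have RF: "R \<subseteq> carrier F" unfolding R_def by (rule horner_sums_carrier[OF RxF F(2)])
  have M0: "\<zero> \<in> M" unfolding M_def by (rule range_eqI[of _ _ 0]) simp
  have M1: "\<one> \<in> M" unfolding M_def by (rule range_eqI[of _ _ 1]) simp
  have M_add: "a \<oplus> b \<in> M" if "a \<in> M" "b \<in> M" for a b
    using that by (auto simp: M_def add.nat_pow_mult)
  have Rx0: "\<zero> \<in> R\<^sub>x" unfolding R\<^sub>x_def by (rule horner_sums.zero)
  have Rx_add: "a \<oplus> b \<in> R\<^sub>x" if "a \<in> R\<^sub>x" "b \<in> R\<^sub>x" for a b
    using horner_sums_add[OF MF F(1) M_add] that unfolding R\<^sub>x_def by blast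
  have Rx_x: "x \<otimes> a \<in> R\<^sub>x" if "a \<in> R\<^sub>x" for a
    using horner_sums_mult_point[OF MF F(1) M0] that unfolding R\<^sub>x_def by blast
  have R0: "\<zero> \<in> R" unfolding R_def by (rule horner_sums.zero)
  have R_add: "a \<oplus> b \<in> R" if "a \<in> R" "b \<in> R" for a b
    using horner_sums_add[OF RxF F(2) Rx_add] that unfolding R_def by blast
  have R_x: "x \<otimes> a \<in> R" if "a \<in> R" for a
    using horner_sums_mult[OF RxF F(2,1) Rx_x] that unfolding R_def by blast
  have R_y: "y \<otimes> a \<in> R" if "a \<in> R" for a
    using horner_sums_mult_point[OF RxF F(2) Rx0] that unfolding R_def by blast
  have "\<one> \<in> R\<^sub>x" unfolding R\<^sub>x_def by (rule subset_horner_sums[OF MF F(1) M1])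
  then have R1: "\<one> \<in> R" unfolding R_def by (rule subset_horner_sums[OF RxF F(2)])
  obtain K\<^sub>1 where K\<^sub>1: "compactin T K\<^sub>1" "\<zero> \<in> K\<^sub>1" "\<And>d k. \<lbrakk>d \<in> K\<^sub>0; k \<in> K\<^sub>1\<rbrakk> \<Longrightarrow> d \<oplus> x \<otimes> k \<in> K\<^sub>1"
    by (rule compact_horner_invariant[OF nondiscrete K\<^sub>0(1) x]) blast
  obtain K\<^sub>2 where K\<^sub>2: "compactin T K\<^sub>2" "\<zero> \<in> K\<^sub>2" "\<And>d k. \<lbrakk>d \<in> K\<^sub>1; k \<in> K\<^sub>2\<rbrakk> \<Longrightarrow> d \<oplus> y \<otimes> k \<in> K\<^sub>2"
    by (rule compact_horner_invariant[OF nondiscrete K\<^sub>1(1) y]) blast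
  have RxK: "R\<^sub>x \<subseteq> K\<^sub>1"
    unfolding R\<^sub>x_def using K\<^sub>0(2) K\<^sub>1(2,3) by (intro horner_sums_subset) (auto simp: M_def)
  have RK: "R \<subseteq> K\<^sub>2"
    unfolding R_def using RxK K\<^sub>2(2,3) by (intro horner_sums_subset) auto
  show ?thesis
  proof (rule top_nilpotentI)
    show "x \<oplus> y \<in> carrier F" using F by simp
    fix U assume U: "openin T U" "\<zero> \<in> U"
    have "\<zero> \<oplus> \<zero> \<in> U" using U(2) by simp
    then obtain V W where VW: "openin T V" "openin T W" "\<zero> \<in> V" "\<zero> \<in> W"
        "\<And>v w. \<lbrakk>v \<in> V; w \<in> W\<rbrakk> \<Longrightarrow> v \<oplus> w \<in> U"
      by (rule nhds_add[OF U(1) zero_closed zero_closed]) blast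
    obtain a where a: "\<And>n c. \<lbrakk>a \<le> n; c \<in> K\<^sub>2\<rbrakk> \<Longrightarrow> x [^] (n::nat) \<otimes> c \<in> V"
      by (rule top_nilpotent_absorbs[OF x K\<^sub>2(1) VW(1,3)]) blast
    obtain b where b: "\<And>n c. \<lbrakk>b \<le> n; c \<in> K\<^sub>2\<rbrakk> \<Longrightarrow> y [^] (n::nat) \<otimes> c \<in> W"
      by (rule top_nilpotent_absorbs[OF y K\<^sub>2(1) VW(2,4)]) blast
    have "(x \<oplus> y) [^] n \<in> U" if "a + b \<le> n" for n :: nat
    proof -
      obtain r s where rs: "r \<in> R" "s \<in> R"
          "(x \<oplus> y) [^] (a + (n - a)) = x [^] a \<otimes> r \<oplus> y [^] (n - a) \<otimes> s"
        using add_pow_split[OF F RF R0 R1 R_add R_x R_y, of a "n - a"] by blast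
      have "x [^] a \<otimes> r \<in> V" "y [^] (n - a) \<otimes> s \<in> W"
        using a[of a r] b[of "n - a" s] rs(1,2) RK that by auto
      then show ?thesis using VW(5) rs(3) that by simp
    qed
    then show "\<exists>m. \<forall>n\<ge>m. (x \<oplus> y) [^] (n::nat) \<in> U" by blast
  qed
qed

lemma open_subgroup_if_bounded_prime_ring:
  assumes "\<not> openin T {\<zero>}" "compactin T K\<^sub>0" "\<And>n::nat. [n] \<cdot> \<one> \<in> K\<^sub>0"
  shows "\<exists>P. openin T P \<and> \<zero> \<in> P \<and> (\<forall>a\<in>P. \<forall>b\<in>P. a \<ominus> b \<in> P) \<and> \<one> \<notin> P"
proof (intro exI conjI ballI)
  let ?P = "{x. top_nilpotent x}"
  note add = top_nilpotent_add[OF assms]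
  show "\<zero> \<in> ?P" "\<one> \<notin> ?P" by (simp_all add: top_nilpotent_zero not_top_nilpotent_one)
  show "a \<ominus> b \<in> ?P" if "a \<in> ?P" "b \<in> ?P" for a b
    using that add top_nilpotent_minus by (simp add: a_minus_def)
  obtain W where W: "openin T W" "\<zero> \<in> W" "\<And>w. w \<in> W \<Longrightarrow> top_nilpotent w"
    by (rule nhd_of_top_nilpotents) blast
  have "\<exists>V. openin T V \<and> p \<in> V \<and> V \<subseteq> ?P" if "p \<in> ?P" for p
  proof (intro exI conjI)
    let ?V = "{z \<in> topspace T. \<ominus> p \<oplus> z \<in> W}"
    have p: "top_nilpotent p" "p \<in> carrier F" using that by (simp_all add: top_nilpotent_carrier)
    then show "openin T ?V"
      by (intro openin_continuous_map_preimage[OF continuous_map_translate W(1)]) simp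
    show "p \<in> ?V" using p W(2) by (simp add: topspace_eq l_neg)
    show "?V \<subseteq> ?P"
    proof
      fix z assume "z \<in> ?V"
      then have z: "z \<in> carrier F" "top_nilpotent (\<ominus> p \<oplus> z)"
        using W(3) by (simp_all add: topspace_eq)
      have "p \<oplus> (\<ominus> p \<oplus> z) = z" using p z(1) by (simp add: a_assoc[symmetric] r_neg)
      then show "z \<in> ?P" using add[OF p(1) z(2)] by simp
    qed
  qed
  then show "openin T ?P" by (subst openin_subopen) blast
qed

section \<open>Unbounded prime ring: a path from zero to one\<close>

text \<open>Fix a topologically nilpotent \<open>t \<noteq> \<zero>\<close>. A nonzero \<open>c\<close> outside the compact set is
  \<open>t [^] (- k)\<close> times an element of the compact set \<open>E = B - t N\<close>, which omits zero, with \<open>k\<close>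
  large. Then the inverse of \<open>c\<close> is \<open>t [^] k\<close> times an element of the inverse of \<open>E\<close>, hence is small.\<close>

lemma top_nilpotent_inverse_outside_compact:
  assumes nondiscrete: "\<not> openin T {\<zero>}"
  obtains K where "compactin T K" "\<zero> \<in> K"
    "\<And>c. \<lbrakk>c \<in> carrier F; c \<notin> K\<rbrakk> \<Longrightarrow> top_nilpotent (inv c)"
proof -
  obtain W where W: "openin T W" "\<zero> \<in> W" "\<And>w. w \<in> W \<Longrightarrow> top_nilpotent w"
    by (rule nhd_of_top_nilpotents) blast
  obtain t where t: "t \<in> W" "t \<in> carrier F" "t \<noteq> \<zero>"
    by (rule nonzero_in_nhd[OF nondiscrete W(1,2)])
  have nil: "top_nilpotent t" using W(3) t(1) .
  define u where "u = inv t"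
  have u: "u \<in> carrier F" "u \<otimes> t = \<one>" using t by (simp_all add: u_def field_Units)
  have cancel: "u [^] k \<otimes> (t [^] k \<otimes> c) = c" if "c \<in> carrier F" for k :: nat and c
    using that t(2) u by (simp add: m_assoc[symmetric] nat_pow_distrib[symmetric])
  define E where "E = B - (\<lambda>a. t \<otimes> a) ` N"
  have "closedin T (topspace T - (\<lambda>a. t \<otimes> a) ` N)"
    using openin_scale[OF openin_N t(2,3)] by blast
  then have "compactin T (B \<inter> (topspace T - (\<lambda>a. t \<otimes> a) ` N))"
    by (rule compact_Int_closedin[OF compactin_B])
  moreover have "B \<inter> (topspace T - (\<lambda>a. t \<otimes> a) ` N) = E"
    unfolding E_def using compactin_subset_topspace[OF compactin_B] by blast
  ultimately have E: "compactin T E" by simp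
  have "t \<otimes> \<zero> \<in> (\<lambda>a. t \<otimes> a) ` N" using zero_in_N by blast
  then have "\<zero> \<notin> E" using t(2) by (simp add: E_def)
  then have E_sub: "E \<subseteq> carrier F - {\<zero>}" using compactin_subset_carrier[OF E] by blast
  then have "compactin (subtopology T (carrier F - {\<zero>})) E"
    using E by (simp add: compactin_subtopology)
  from image_compactin[OF this continuous_inv] have E': "compactin T ((\<lambda>a. inv a) ` E)" .
  obtain m where m: "\<And>n c. \<lbrakk>m \<le> n; c \<in> (\<lambda>a. inv a) ` E\<rbrakk> \<Longrightarrow> t [^] (n::nat) \<otimes> c \<in> W"
    by (rule top_nilpotent_absorbs[OF nil E' W(1,2)]) blast
  define K where "K = (\<Union>k\<in>{..m}. (\<lambda>b. u [^] k \<otimes> b) ` B)"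
  have "compactin T K"
    unfolding K_def using u(1) by (intro compactin_Union) (auto intro: compactin_scale[OF compactin_B])
  moreover have "u [^] (0::nat) \<otimes> \<zero> \<in> K"
    unfolding K_def using zero_in_B by blast
  then have "\<zero> \<in> K" by simp
  moreover have "top_nilpotent (inv c)" if c: "c \<in> carrier F" "c \<notin> K" for c
  proof -
    have outside: "t [^] k \<otimes> c \<notin> B" if "k \<le> m" for k
    proof
      assume "t [^] k \<otimes> c \<in> B"
      then have "u [^] k \<otimes> (t [^] k \<otimes> c) \<in> K" unfolding K_def using that by blast
      then show False using c cancel by simp
    qed
    have "compactin T {c}" using c(1) by (simp add: topspace_eq)
    then obtain j where "\<And>n b. \<lbrakk>j \<le> n; b \<in> {c}\<rbrakk> \<Longrightarrow> t [^] (n::nat) \<otimes> b \<in> N"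
      by (rule top_nilpotent_absorbs[OF nil _ openin_N zero_in_N]) blast
    then have "t [^] j \<otimes> c \<in> B" using N_subset_B by blast
    define k where "k = (LEAST k::nat. t [^] k \<otimes> c \<in> B)"
    have k: "t [^] k \<otimes> c \<in> B"
      unfolding k_def by (rule LeastI) (rule \<open>t [^] j \<otimes> c \<in> B\<close>)
    have "m < k" using k outside[of k] by (cases "k \<le> m") auto
    then obtain i where i: "k = Suc i" by (cases k) auto
    have "t [^] i \<otimes> c \<notin> B"
      using not_less_Least[of i "\<lambda>k::nat. t [^] k \<otimes> c \<in> B"] unfolding k_def[symmetric] i by simp
    have "t [^] k \<otimes> c \<notin> (\<lambda>a. t \<otimes> a) ` N"
    proof
      assume "t [^] k \<otimes> c \<in> (\<lambda>a. t \<otimes> a) ` N"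
      then obtain a where a: "a \<in> N" "t [^] k \<otimes> c = t \<otimes> a" by blast
      have "a \<in> carrier F" using a(1) openin_subset_carrier[OF openin_N] by blast
      moreover have "t \<otimes> (t [^] i \<otimes> c) = t \<otimes> a"
        using a(2) t(2) c(1) by (simp add: i m_ac)
      ultimately have "t [^] i \<otimes> c = a" using t c(1) by (simp add: m_lcancel)
      then show False using \<open>t [^] i \<otimes> c \<notin> B\<close> a(1) N_subset_B by blast
    qed
    then have e: "t [^] k \<otimes> c \<in> E" using k by (simp add: E_def)
    then have unit: "t [^] k \<otimes> c \<in> carrier F" "t [^] k \<otimes> c \<noteq> \<zero>" using E_sub by auto
    define v where "v = inv (t [^] k \<otimes> c)"
    have v: "v \<in> carrier F" "v \<otimes> (t [^] k \<otimes> c) = \<one>"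
      using unit by (simp_all add: v_def field_Units)
    have small: "t [^] k \<otimes> v \<in> W"
      using m[of k v] \<open>m < k\<close> e by (auto simp: v_def)
    have "c \<otimes> (t [^] k \<otimes> v) = \<one>" "(t [^] k \<otimes> v) \<otimes> c = \<one>"
      using v c(1) t(2) by (simp_all add: m_ac)
    then have "t [^] k \<otimes> v = inv c"
      using v(1) t(2) c(1) by (intro inv_unique') auto
    then show ?thesis using W(3) small by metis
  qed
  ultimately show ?thesis by (rule that)
qed

end

text \<open>For \<open>r\<close> between zero and one, the integer formed by the first \<open>k\<close> digits of \<open>r\<close> in base \<open>n\<close>.\<close>

definition digits_prefix :: "nat \<Rightarrow> nat \<Rightarrow> real \<Rightarrow> nat" where
  "digits_prefix n k r = nat \<lfloor>r * real n ^ k\<rfloor>"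

lemma digits_prefix_Suc:
  assumes "0 \<le> r" "0 < n"
  obtains d where "d < n" "digits_prefix n (Suc k) r = n * digits_prefix n k r + d"
proof -
  define z where "z = r * real n ^ k"
  have z: "0 \<le> z" using assms by (simp add: z_def)
  have eq: "r * real n ^ Suc k = real n * z" by (simp add: z_def)
  have "real n * of_int \<lfloor>z\<rfloor> \<le> real n * z"
    by (intro mult_left_mono) simp_all
  then have lower: "int n * \<lfloor>z\<rfloor> \<le> \<lfloor>real n * z\<rfloor>"
    by (simp add: le_floor_iff)
  have "real n * z < real n * (of_int \<lfloor>z\<rfloor> + 1)"
    using assms(2) by (intro mult_strict_left_mono) simp_all
  then have upper: "\<lfloor>real n * z\<rfloor> < int n * \<lfloor>z\<rfloor> + int n"
    by (simp add: floor_less_iff algebra_simps)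
  have floor_nonneg: "0 \<le> \<lfloor>z\<rfloor>" using z by simp
  define d where "d = nat (\<lfloor>real n * z\<rfloor> - int n * \<lfloor>z\<rfloor>)"
  have "d < n" using lower upper by (simp add: d_def)
  moreover have "int (nat \<lfloor>real n * z\<rfloor>) = int (n * nat \<lfloor>z\<rfloor> + d)"
    using lower floor_nonneg by (simp add: d_def)
  then have "digits_prefix n (Suc k) r = n * digits_prefix n k r + d"
    unfolding digits_prefix_def eq z_def[symmetric] by (simp only: of_nat_eq_iff)
  ultimately show ?thesis by (rule that)
qed

lemma digits_prefix_close:
  assumes "0 < n" "\<bar>s - r\<bar> < 1 / real n ^ k"
  shows "digits_prefix n k s = digits_prefix n k r
    \<or> digits_prefix n k s = Suc (digits_prefix n k r) \<or> digits_prefix n k r = Suc (digits_prefix n k s)"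
proof -
  have "\<bar>s - r\<bar> * real n ^ k < 1"
    using assms by (simp add: pos_less_divide_eq)
  then have "\<bar>s * real n ^ k - r * real n ^ k\<bar> < 1"
    by (simp add: abs_mult left_diff_distrib[symmetric])
  then have "\<bar>\<lfloor>s * real n ^ k\<rfloor> - \<lfloor>r * real n ^ k\<rfloor>\<bar> \<le> 1"
    by linarith
  then show ?thesis
    unfolding digits_prefix_def by linarith
qed

context topological_field
begin

lemma eq_zero_if_in_all_nhds:
  assumes "z \<in> carrier F" "\<And>U. \<lbrakk>openin T U; \<zero> \<in> U\<rbrakk> \<Longrightarrow> z \<in> U"
  shows "z = \<zero>"
proof (rule ccontr)
  assume "z \<noteq> \<zero>"
  have "closedin T {z}"
    using closedin_Hausdorff_singleton[OF Hausdorff_space] assms(1) topspace_eq by simp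
  then have "openin T (topspace T - {z})" by blast
  moreover have "\<zero> \<in> topspace T - {z}"
    using \<open>z \<noteq> \<zero>\<close> by (auto simp: topspace_eq)
  ultimately have "z \<in> topspace T - {z}" by (rule assms(2))
  then show False by simp
qed

end

context locally_compact_field
begin

text \<open>If the inverse \<open>u\<close> of the natural number \<open>n\<close> is topologically nilpotent, the base-\<open>n\<close> expansion of
  real numbers makes sense in \<^term>\<open>F\<close>: the value at \<open>r\<close> is a point common to the nested
  compact sets of all elements whose expansion begins with the first \<open>k\<close> digits of \<open>r\<close>. If \<open>s\<close> is
  closer to \<open>r\<close> than \<open>1 / n ^ k\<close>, the integers formed by their first \<open>k\<close> digits differ by at most
  one, so their values differ by \<open>u [^] k\<close> times an element of a fixed compact set \<open>Q\<close>, which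
  gives continuity.\<close>

lemma path_if_nilpotent_inverse:
  fixes n :: nat
  assumes nondiscrete: "\<not> openin T {\<zero>}"
    and n_nonzero: "[n] \<cdot> \<one> \<noteq> \<zero>" and nil: "top_nilpotent (inv ([n] \<cdot> \<one>))"
  obtains \<gamma> :: "real \<Rightarrow> 'a" where "continuous_map (top_of_set {0..1}) T \<gamma>" "\<gamma> 0 = \<zero>" "\<gamma> 1 = \<one>"
proof -
  define \<iota> where "\<iota> k = [k] \<cdot> \<one>" for k :: nat
  define u where "u = inv (\<iota> n)"
  have \<iota>: "\<iota> k \<in> carrier F" for k by (simp add: \<iota>_def)
  have \<iota>_add: "\<iota> (j + k) = \<iota> j \<oplus> \<iota> k" for j k by (simp add: \<iota>_def add.nat_pow_mult)
  have \<iota>0: "\<iota> 0 = \<zero>" and \<iota>1: "\<iota> (Suc 0) = \<one>" by (simp_all add: \<iota>_def)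
  have \<iota>_mult: "\<iota> (j * k) = \<iota> j \<otimes> \<iota> k" for j k
  proof (induction j)
    case (Suc j)
    have "\<iota> (Suc j * k) = \<iota> k \<oplus> \<iota> j \<otimes> \<iota> k" using Suc by (simp add: \<iota>_add)
    also have "\<dots> = (\<iota> (Suc 0) \<oplus> \<iota> j) \<otimes> \<iota> k" using \<iota> by (simp add: \<iota>1 l_distr)
    also have "\<dots> = \<iota> (Suc j) \<otimes> \<iota> k" using \<iota>_add[of "Suc 0" j] by simp
    finally show ?case .
  qed (use \<iota> in \<open>simp add: \<iota>0\<close>)
  have u: "u \<in> carrier F" "\<iota> n \<otimes> u = \<one>"
    using n_nonzero \<iota>[of n] by (simp_all add: u_def \<iota>_def field_Units)
  have u_nil: "top_nilpotent u" using nil by (simp add: u_def \<iota>_def)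
  have "n \<noteq> 0" using n_nonzero by (metis \<iota>0 \<iota>_def)
  then have n_pos: "0 < n" by simp
  have "n \<noteq> 1" using not_top_nilpotent_one u_nil u \<iota>1 by auto
  with n_pos have n2: "1 < real n" by simp
  have "compactin T (\<iota> ` {..<n})"
    using \<iota> by (intro finite_imp_compactin) (auto simp: topspace_eq)
  then obtain K where K: "compactin T K" "\<zero> \<in> K"
      "\<And>d k. \<lbrakk>d \<in> \<iota> ` {..<n}; k \<in> K\<rbrakk> \<Longrightarrow> d \<oplus> u \<otimes> k \<in> K"
    by (rule compact_horner_invariant[OF nondiscrete _ u_nil]) blast
  have KF: "K \<subseteq> carrier F" by (rule compactin_subset_carrier[OF K(1)])
  define cylinder where
    "cylinder r k = (\<lambda>z. \<iota> (digits_prefix n k r) \<otimes> u [^] k \<oplus> u [^] Suc k \<otimes> z) ` K" for r k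
  have cylinder_compact: "compactin T (cylinder r k)" for r k
    unfolding cylinder_def using u(1) \<iota> K(1)
    by (intro image_compactin[OF K(1)] continuous_map_add continuous_map_scale)
      (simp_all add: topspace_eq)
  have cylinder_Suc: "cylinder r (Suc k) \<subseteq> cylinder r k" if "0 \<le> r" for r k
  proof
    fix y assume "y \<in> cylinder r (Suc k)"
    then obtain z where z: "z \<in> K"
        "y = \<iota> (digits_prefix n (Suc k) r) \<otimes> u [^] Suc k \<oplus> u [^] Suc (Suc k) \<otimes> z"
      unfolding cylinder_def by blast
    define a where "a = digits_prefix n k r"
    obtain d where d: "d < n" "digits_prefix n (Suc k) r = n * a + d"
      unfolding a_def by (rule digits_prefix_Suc[OF \<open>0 \<le> r\<close> n_pos])
    have zF: "z \<in> carrier F" using z(1) KF by blast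
    have "\<iota> (n * a + d) \<otimes> u [^] Suc k = (\<iota> n \<otimes> u) \<otimes> (\<iota> a \<otimes> u [^] k) \<oplus> u [^] Suc k \<otimes> \<iota> d"
      using \<iota> u(1) by (simp add: \<iota>_add \<iota>_mult l_distr r_distr m_ac)
    then have "y = \<iota> a \<otimes> u [^] k \<oplus> u [^] Suc k \<otimes> (\<iota> d \<oplus> u \<otimes> z)"
      using \<iota> u zF by (simp add: z(2) d(2) r_distr m_ac a_ac)
    moreover have "\<iota> d \<oplus> u \<otimes> z \<in> K" using K(3) d(1) z(1) by blast
    ultimately show "y \<in> cylinder r k" unfolding cylinder_def a_def by blast
  qed
  have "\<exists>y. \<forall>k. y \<in> cylinder r k" if r: "0 \<le> r" for r
  proof -
    define C where "C = cylinder r 0"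
    have dec: "decseq (cylinder r)"
      using cylinder_Suc[OF r] by (rule decseq_SucI)
    then have sub: "cylinder r k \<subseteq> C" for k unfolding C_def by (simp add: decseqD)
    have "(\<Inter>k. cylinder r k) \<noteq> {}"
    proof (rule compact_space_imp_nest[of "subtopology T C"])
      show "compact_space (subtopology T C)"
        unfolding C_def by (rule compact_space_subtopology[OF cylinder_compact])
      have "closedin T (cylinder r k)" for k
        by (rule compactin_imp_closedin[OF Hausdorff_space cylinder_compact])
      then show "closedin (subtopology T C) (cylinder r k)" for k
        by (rule closedin_subset_topspace) (rule sub)
      show "cylinder r k \<noteq> {}" for k unfolding cylinder_def using K(2) by blast
    qed (rule dec)
    then show ?thesis by blast
  qed
  then have "\<forall>r. \<exists>y. 0 \<le> r \<longrightarrow> (\<forall>k. y \<in> cylinder r k)" by blast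
  from choice[OF this] obtain \<gamma> where \<gamma>: "\<And>r k. 0 \<le> r \<Longrightarrow> \<gamma> r \<in> cylinder r k" by blast
  have \<gamma>F: "\<gamma> r \<in> carrier F" if "0 \<le> r" for r
    using \<gamma>[OF that] compactin_subset_carrier[OF cylinder_compact] by blast
  have \<gamma>_expand: "\<exists>z\<in>K. \<gamma> r = \<iota> (digits_prefix n k r) \<otimes> u [^] k \<oplus> u [^] Suc k \<otimes> z"
    if "0 \<le> r" for r k
    using \<gamma>[OF that, of k] unfolding cylinder_def by blast
  have start: "\<gamma> 0 = \<zero>"
  proof (rule eq_zero_if_in_all_nhds[OF \<gamma>F])
    fix U assume U: "openin T U" "\<zero> \<in> U"
    obtain m where m: "\<And>k z. \<lbrakk>m \<le> k; z \<in> K\<rbrakk> \<Longrightarrow> u [^] (k::nat) \<otimes> z \<in> U"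
      by (rule top_nilpotent_absorbs[OF u_nil K(1) U]) blast
    obtain z where z: "z \<in> K" "\<gamma> 0 = \<iota> (digits_prefix n m 0) \<otimes> u [^] m \<oplus> u [^] Suc m \<otimes> z"
      using \<gamma>_expand[of 0 m] by auto
    have "\<gamma> 0 = u [^] Suc m \<otimes> z"
      using z KF u(1) by (auto simp: digits_prefix_def \<iota>0)
    then show "\<gamma> 0 \<in> U" using m[OF _ z(1), of "Suc m"] by simp
  qed simp
  have "\<gamma> 1 \<ominus> \<one> = \<zero>"
  proof (rule eq_zero_if_in_all_nhds)
    show "\<gamma> 1 \<ominus> \<one> \<in> carrier F" using \<gamma>F[of 1] by simp
    fix U assume U: "openin T U" "\<zero> \<in> U"
    obtain m where m: "\<And>k z. \<lbrakk>m \<le> k; z \<in> K\<rbrakk> \<Longrightarrow> u [^] (k::nat) \<otimes> z \<in> U"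
      by (rule top_nilpotent_absorbs[OF u_nil K(1) U]) blast
    obtain z where z: "z \<in> K" "\<gamma> 1 = \<iota> (digits_prefix n m 1) \<otimes> u [^] m \<oplus> u [^] Suc m \<otimes> z"
      using \<gamma>_expand[of 1 m] by auto
    have "digits_prefix n m 1 = n ^ m"
      unfolding digits_prefix_def by (simp add: of_nat_power[symmetric] del: of_nat_power)
    moreover have "\<iota> (n ^ m) \<otimes> u [^] m = \<one>"
    proof (induction m)
      case (Suc m)
      have "\<iota> (n ^ Suc m) \<otimes> u [^] Suc m = (\<iota> n \<otimes> u) \<otimes> (\<iota> (n ^ m) \<otimes> u [^] m)"
        using \<iota> u(1) by (simp add: \<iota>_mult m_ac)
      then show ?case using Suc u(2) by simp
    qed (simp add: \<iota>1)
    moreover have zF: "z \<in> carrier F" using z(1) KF by blast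
    ultimately have "\<gamma> 1 \<ominus> \<one> = u [^] Suc m \<otimes> z \<oplus> (\<one> \<ominus> \<one>)"
      using z(2) u(1) by (simp add: a_minus_def a_ac)
    also have "\<dots> = u [^] Suc m \<otimes> z" using zF u(1) by simp
    finally show "\<gamma> 1 \<ominus> \<one> \<in> U" using m[OF _ z(1), of "Suc m"] by simp
  qed
  then have finish: "\<gamma> 1 = \<one>" using \<gamma>F[of 1] by simp
  have cont: "continuous_map (top_of_set {0..1}) T \<gamma>"
    unfolding continuous_map
  proof (intro conjI allI impI)
    show "\<gamma> ` topspace (top_of_set {0..1}) \<subseteq> topspace T"
      using \<gamma>F by (auto simp: topspace_eq)
    fix V assume V: "openin T V"
    \<comment> \<open>The compact set \<open>Q\<close> of all \<open>e + u (z - y)\<close> with \<open>y\<close> and \<open>z\<close> in \<open>K\<close> and \<open>e\<close> among \<open>0\<close>, \<open>1\<close>, \<open>-1\<close>, the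
      possible differences of the prefixes, collects all quotients \<open>(\<gamma> s - \<gamma> r) / u ^ k\<close>.\<close>
    define D where "D = (\<lambda>z. fst z \<ominus> snd z) ` (K \<times> K)"
    have "compactin T D"
      unfolding D_def
      by (rule image_compactin[of "prod_topology T T"])
        (auto simp: compactin_Times K(1) intro: continuous_map_diff continuous_map_fst continuous_map_snd)
    moreover have "compactin T {\<zero>, \<one>, \<ominus> \<one>}"
      by (rule finite_imp_compactin) (simp_all add: topspace_eq)
    ultimately have Q: "compactin T ((\<lambda>(a, b). a \<oplus> b) ` ({\<zero>, \<one>, \<ominus> \<one>} \<times> (\<lambda>z. u \<otimes> z) ` D))"
      (is "compactin T ?Q")
      using u(1) by (intro compactin_add compactin_scale)
    have "\<exists>e>0. \<forall>s\<in>{0..1}. dist s r < e \<longrightarrow> s \<in> {r \<in> {0..1}. \<gamma> r \<in> V}"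
      if r: "r \<in> {0..1}" "\<gamma> r \<in> V" for r
    proof -
      have r0: "0 \<le> r" using r(1) by simp
      have "openin T {z \<in> topspace T. \<gamma> r \<oplus> z \<in> V}"
        by (rule openin_continuous_map_preimage[OF continuous_map_translate[OF \<gamma>F[OF r0]] V])
      moreover have "\<zero> \<in> {z \<in> topspace T. \<gamma> r \<oplus> z \<in> V}"
        using r(2) \<gamma>F[OF r0] by (simp add: topspace_eq)
      ultimately obtain k where k: "\<And>j q. \<lbrakk>k \<le> j; q \<in> ?Q\<rbrakk> \<Longrightarrow>
          u [^] (j::nat) \<otimes> q \<in> {z \<in> topspace T. \<gamma> r \<oplus> z \<in> V}"
        by (rule top_nilpotent_absorbs[OF u_nil Q]) blast
      have "\<gamma> s \<in> V" if s: "s \<in> {0..1}" "dist s r < 1 / real n ^ k" for s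
      proof -
        have s0: "0 \<le> s" using s(1) by simp
        obtain y where y: "y \<in> K" "\<gamma> r = \<iota> (digits_prefix n k r) \<otimes> u [^] k \<oplus> u [^] Suc k \<otimes> y"
          using \<gamma>_expand[OF r0, of k] by blast
        obtain z where z: "z \<in> K" "\<gamma> s = \<iota> (digits_prefix n k s) \<otimes> u [^] k \<oplus> u [^] Suc k \<otimes> z"
          using \<gamma>_expand[OF s0, of k] by blast
        have F: "y \<in> carrier F" "z \<in> carrier F" using y(1) z(1) KF by auto
        have \<iota>_Suc: "\<iota> (Suc j) = \<iota> j \<oplus> \<one>" for j using \<iota>_add[of j "Suc 0"] \<iota>1 by simp
        have "\<exists>e\<in>{\<zero>, \<one>, \<ominus> \<one>}. \<iota> (digits_prefix n k s) = \<iota> (digits_prefix n k r) \<oplus> e"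
        proof -
          have "\<bar>s - r\<bar> < 1 / real n ^ k" using s(2) by (simp add: dist_real_def)
          from digits_prefix_close[OF n_pos this] show ?thesis
          proof (elim disjE)
            assume "digits_prefix n k r = Suc (digits_prefix n k s)"
            then have "\<iota> (digits_prefix n k s) = \<iota> (digits_prefix n k r) \<oplus> \<ominus> \<one>"
              using \<iota> by (simp add: \<iota>_Suc a_assoc r_neg)
            then show ?thesis by blast
          qed (use \<iota> in \<open>simp_all add: \<iota>_Suc\<close>)
        qed
        then obtain e where e: "e \<in> {\<zero>, \<one>, \<ominus> \<one>}"
            "\<iota> (digits_prefix n k s) = \<iota> (digits_prefix n k r) \<oplus> e" by blast
        have eF: "e \<in> carrier F" using e(1) by auto
        have yz: "y \<oplus> (z \<ominus> y) = z" using F by (simp add: a_minus_def a_lcomm[of y z "\<ominus> y"] r_neg)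
        have "\<gamma> r \<oplus> u [^] k \<otimes> (e \<oplus> u \<otimes> (z \<ominus> y))
            = (\<iota> (digits_prefix n k r) \<oplus> e) \<otimes> u [^] k \<oplus> u [^] Suc k \<otimes> (y \<oplus> (z \<ominus> y))"
          using F eF \<iota> u(1) by (simp add: y(2) l_distr r_distr m_ac a_ac)
        then have eq: "\<gamma> r \<oplus> u [^] k \<otimes> (e \<oplus> u \<otimes> (z \<ominus> y)) = \<gamma> s"
          using z(2) e(2) yz by simp
        have "z \<ominus> y \<in> D" unfolding D_def using y(1) z(1) by force
        then have "e \<oplus> u \<otimes> (z \<ominus> y) \<in> ?Q" using e(1) by blast
        from k[OF order.refl this] have "\<gamma> r \<oplus> u [^] k \<otimes> (e \<oplus> u \<otimes> (z \<ominus> y)) \<in> V"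
          unfolding mem_Collect_eq by (rule conjunct2)
        then show ?thesis unfolding eq .
      qed
      then show ?thesis
        using n_pos r by (intro exI[of _ "1 / real n ^ k"]) auto
    qed
    then show "openin (top_of_set {0..1}) {r \<in> topspace (top_of_set {0..1}). \<gamma> r \<in> V}"
      unfolding openin_euclidean_subtopology_iff topspace_euclidean_subtopology by blast
  qed
  show ?thesis by (rule that[OF cont start finish])
qed

end

section \<open>Bump functions\<close>

context topological_field
begin

text \<open>The dilations behind the boundedness of Horner sums need small nonzero elements, so a
  discrete field is treated apart, with the subgroup \<open>{\<zero>}\<close>.\<close>

lemma open_subgroup_or_path:
  assumes "openin T N" "\<zero> \<in> N" "compactin T B" "N \<subseteq> B"
  obtains (subgroup) P where "openin T P" "\<zero> \<in> P" "\<one> \<notin> P" "\<And>a b. \<lbrakk>a \<in> P; b \<in> P\<rbrakk> \<Longrightarrow> a \<ominus> b \<in> P"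
  | (path) \<gamma> :: "real \<Rightarrow> 'f" where "continuous_map (top_of_set {0..1}) T \<gamma>" "\<gamma> 0 = \<zero>" "\<gamma> 1 = \<one>"
proof -
  interpret locally_compact_field F T N B
    by unfold_locales (fact assms)+
  consider "openin T {\<zero>}"
    | "\<not> openin T {\<zero>}" "\<exists>K. compactin T K \<and> (\<forall>n::nat. [n] \<cdot> \<one> \<in> K)"
    | "\<not> openin T {\<zero>}" "\<not> (\<exists>K. compactin T K \<and> (\<forall>n::nat. [n] \<cdot> \<one> \<in> K))"
    by blast
  then show ?thesis
  proof cases
    case 1
    then show ?thesis by (rule subgroup[of "{\<zero>}"]) simp_all
  next
    case 2
    then obtain K where "compactin T K" "\<And>n::nat. [n] \<cdot> \<one> \<in> K" by blast
    from open_subgroup_if_bounded_prime_ring[OF 2(1) this]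
    obtain P where "openin T P" "\<zero> \<in> P" "\<one> \<notin> P" "\<forall>a\<in>P. \<forall>b\<in>P. a \<ominus> b \<in> P"
      by (elim exE conjE)
    then show ?thesis by (intro subgroup[of P]) simp_all
  next
    case 3
    obtain K where K: "compactin T K" "\<zero> \<in> K"
        "\<And>c. \<lbrakk>c \<in> carrier F; c \<notin> K\<rbrakk> \<Longrightarrow> top_nilpotent (inv c)"
      by (rule top_nilpotent_inverse_outside_compact[OF 3(1)]) blast
    obtain n :: nat where n: "[n] \<cdot> \<one> \<notin> K" using 3(2) K(1) by blast
    then have "[n] \<cdot> \<one> \<noteq> \<zero>" using K(2) by auto
    moreover have "top_nilpotent (inv ([n] \<cdot> \<one>))" using K(3) n by simp
    ultimately show ?thesis
      by (rule path_if_nilpotent_inverse[OF 3(1)]) (rule path)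
  qed
qed

lemma tychonoff_overD:
  assumes "tychonoff_over F T S" "closedin S C \<and> x \<in> topspace S - C"
  shows "\<exists>f. continuous_map S T f \<and> f x = \<one> \<and> (\<forall>y\<in>C. f y = \<zero>)"
  using assms(1)[unfolded tychonoff_over_def, THEN conjunct2, rule_format, OF assms(2)] .

lemma compact_tychonoff_shrink:
  assumes "compact_space S" "tychonoff_over F T S" "openin S V" "x \<in> V"
  obtains U Y where "openin S U" "closedin S Y" "x \<in> U" "U \<subseteq> Y" "Y \<subseteq> V"
proof -
  have "regular_space S"
    by (rule compact_Hausdorff_imp_regular_space[OF assms(1) tychonoff_over_imp_Hausdorff_space[OF assms(2)]])
  moreover have "closedin S (topspace S - V) \<and> x \<in> topspace S - (topspace S - V)"
    using assms(3,4) openin_subset[OF assms(3)] by auto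
  ultimately obtain U where U: "openin S U" "x \<in> U" "disjnt (topspace S - V) (S closure_of U)"
    unfolding regular_space by blast
  show ?thesis
  proof (rule that[of U "S closure_of U"])
    show "U \<subseteq> S closure_of U" using openin_subset[OF U(1)] by (rule closure_of_subset)
    show "S closure_of U \<subseteq> V" using U(3) closure_of_subset_topspace[of S U] by (auto simp: disjnt_iff)
  qed (use U in auto)
qed

text \<open>A function separating \<open>x\<close> from the complement of \<open>U\<close> need not be constant near \<open>x\<close>.
  An open subgroup \<open>P\<close> remedies this by passing to the set where \<open>f\<close> takes values in the coset of
  one, which is clopen; a path from zero to one remedies it by transporting real Urysohn functions
  to \<^term>\<open>F\<close>.\<close>

lemma bump_function:
  assumes S: "compact_space S" "tychonoff_over F T S"
    and nhd: "openin T N" "\<zero> \<in> N" "compactin T B" "N \<subseteq> B"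
    and U: "openin S U" "x \<in> U"
  obtains h V where "continuous_map S T h" "openin S V" "x \<in> V" "V \<subseteq> U"
    "\<And>y. y \<in> V \<Longrightarrow> h y = \<one>" "\<And>y. y \<in> topspace S - U \<Longrightarrow> h y = \<zero>"
  using nhd
proof (cases rule: open_subgroup_or_path)
  case (subgroup P)
  have "closedin S (topspace S - U) \<and> x \<in> topspace S - (topspace S - U)"
    using U openin_subset[OF U(1)] by auto
  from tychonoff_overD[OF S(2) this]
  obtain f where f: "continuous_map S T f" "f x = \<one>" "\<And>y. y \<in> topspace S - U \<Longrightarrow> f y = \<zero>"
    by blast
  note carr = continuous_map_carrier[OF f(1)]
  have PF: "P \<subseteq> carrier F" by (rule openin_subset_carrier[OF subgroup(1)])
  have diff_open: "openin S {y \<in> topspace S. f y \<ominus> c \<in> P}" if "c \<in> carrier F" for c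
    using that by (intro openin_continuous_map_preimage[OF _ subgroup(1)] continuous_map_diff f(1))
      (simp add: topspace_eq)
  have neg: "\<ominus> a \<in> P" if "a \<in> P" for a
    using subgroup(4)[OF subgroup(2) that] PF that by (auto simp: a_minus_def)
  have [simp]: "a \<ominus> a = \<zero>" if "a \<in> carrier F" for a
    using that by (simp add: a_minus_def r_neg)
  define V where "V = {y \<in> topspace S. f y \<ominus> \<one> \<in> P}"
  have V: "openin S V" unfolding V_def by (rule diff_open) simp
  have V': "openin S (topspace S - V)"
  proof (subst openin_subopen, intro ballI)
    fix y assume y: "y \<in> topspace S - V"
    \<comment> \<open>On \<open>W\<close> the values of \<open>f\<close> stay in the coset of \<open>f y\<close>, which is disjoint from that of one.\<close>
    let ?W = "{z \<in> topspace S. f z \<ominus> f y \<in> P}"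
    have yF: "f y \<in> carrier F" using carr y by blast
    have "z \<notin> V" if z: "z \<in> ?W" for z
    proof
      assume "z \<in> V"
      then have zP: "f z \<ominus> \<one> \<in> P" and zF: "f z \<in> carrier F" using carr by (auto simp: V_def)
      have "(f z \<ominus> \<one>) \<ominus> (f z \<ominus> f y) \<in> P" using subgroup(4)[OF zP] z by blast
      moreover have "(f z \<ominus> \<one>) \<ominus> (f z \<ominus> f y) = (f y \<ominus> \<one>) \<oplus> (f z \<ominus> f z)"
        using zF yF by (simp add: a_minus_def minus_add a_ac)
      ultimately have "f y \<ominus> \<one> \<in> P" using zF yF by simp
      then show False using y by (simp add: V_def)
    qed
    moreover have "y \<in> ?W" using y yF subgroup(2) by simp
    ultimately show "\<exists>W. openin S W \<and> y \<in> W \<and> W \<subseteq> topspace S - V"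
      using diff_open[OF yF] by (intro exI[of _ ?W]) auto
  qed
  show ?thesis
  proof (rule that[of "\<lambda>y. if y \<in> V then \<one> else \<zero>" V])
    show "continuous_map S T (\<lambda>y. if y \<in> V then \<one> else \<zero>)"
    proof (rule pasting_lemma[of "{V, topspace S - V}" _ id _ "\<lambda>W y. if W = V then \<one> else \<zero>"])
      show "openin S (id W)" if "W \<in> {V, topspace S - V}" for W
        using that V V' by auto
      show "\<exists>W. W \<in> {V, topspace S - V} \<and> y \<in> id W \<and>
          (if y \<in> V then \<one> else \<zero>) = (if W = V then \<one> else \<zero>)" if "y \<in> topspace S" for y
        using that by (intro exI[of _ "if y \<in> V then V else topspace S - V"]) auto
    qed (auto simp: topspace_eq)
    show "x \<in> V" using U openin_subset[OF U(1)] f(2) subgroup(2) by (auto simp: V_def)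
    show V_sub: "V \<subseteq> U"
    proof
      fix y assume y: "y \<in> V"
      show "y \<in> U"
      proof (rule ccontr)
        assume "y \<notin> U"
        then have "\<zero> \<ominus> \<one> \<in> P" using y f(3)[of y] by (auto simp: V_def)
        then have "\<ominus> (\<zero> \<ominus> \<one>) \<in> P" by (rule neg)
        then show False using subgroup(3) by (simp add: a_minus_def)
      qed
    qed
    show "(if y \<in> V then \<one> else \<zero>) = \<zero>" if "y \<in> topspace S - U" for y
      using that V_sub by auto
  qed (use V in auto)
next
  case (path \<gamma>)
  obtain V Y where VY: "openin S V" "closedin S Y" "x \<in> V" "V \<subseteq> Y" "Y \<subseteq> U"
    by (rule compact_tychonoff_shrink[OF S U])
  have "normal_space S"
    using compact_Hausdorff_or_regular_imp_normal_space S tychonoff_over_imp_Hausdorff_space by blast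
  moreover have "closedin S (topspace S - U)" using U(1) by blast
  moreover have "disjnt (topspace S - U) Y" using VY(5) by (auto simp: disjnt_iff)
  ultimately obtain g where g: "continuous_map S (top_of_set {0..1::real}) g"
      "g ` (topspace S - U) \<subseteq> {0}" "g ` Y \<subseteq> {1}"
    using Urysohn_lemma[of S "topspace S - U" Y 0 1] VY(2) by auto
  show ?thesis
  proof (rule that[of "\<gamma> \<circ> g" V])
    show "continuous_map S T (\<gamma> \<circ> g)" by (rule continuous_map_compose[OF g(1) path(1)])
    show "(\<gamma> \<circ> g) y = \<one>" if "y \<in> V" for y
    proof -
      have "g y = 1" using g(3) VY(4) that by blast
      then show ?thesis using path(3) by simp
    qed
    show "(\<gamma> \<circ> g) y = \<zero>" if "y \<in> topspace S - U" for y
    proof -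
      have "g y = 0" using g(2) that by blast
      then show ?thesis using path(2) by simp
    qed
  qed (use VY in auto)
qed

end

section \<open>Ideals without a common zero\<close>

lemma compact_space_induct:
  assumes "compact_space S" and empty: "P {}"
    and union: "\<And>U V. \<lbrakk>P U; P V\<rbrakk> \<Longrightarrow> P (U \<union> V)"
    and local: "\<And>x. x \<in> topspace S \<Longrightarrow> \<exists>U. openin S U \<and> x \<in> U \<and> P U"
  shows "P (topspace S)"
proof -
  let ?\<U> = "{U. openin S U \<and> P U}"
  have "\<forall>U\<in>?\<U>. openin S U" "topspace S \<subseteq> \<Union>?\<U>" using local by blast+
  then obtain \<F> where \<F>: "finite \<F>" "\<F> \<subseteq> ?\<U>" "topspace S \<subseteq> \<Union>\<F>"
    using assms(1)[unfolded compact_space_alt, rule_format, of ?\<U>] by blast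
  have "P (\<Union>\<F>)" using \<F>(1,2) by (induction \<F>) (auto simp: empty union)
  moreover have "\<Union>\<F> = topspace S" using \<F>(2,3) openin_subset by blast
  ultimately show ?thesis by simp
qed

lemma cont_algebra_simps:
  "carrier (cont_algebra F T S) = {f \<in> extensional (topspace S). continuous_map S T f}"
  "f \<otimes>\<^bsub>cont_algebra F T S\<^esub> g = (\<lambda>x\<in>topspace S. f x \<otimes>\<^bsub>F\<^esub> g x)"
  "f \<oplus>\<^bsub>cont_algebra F T S\<^esub> g = (\<lambda>x\<in>topspace S. f x \<oplus>\<^bsub>F\<^esub> g x)"
  "\<one>\<^bsub>cont_algebra F T S\<^esub> = (\<lambda>x\<in>topspace S. \<one>\<^bsub>F\<^esub>)"
  "\<zero>\<^bsub>cont_algebra F T S\<^esub> = (\<lambda>x\<in>topspace S. \<zero>\<^bsub>F\<^esub>)"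
  "c \<odot>\<^bsub>cont_algebra F T S\<^esub> f = (\<lambda>x\<in>topspace S. c \<otimes>\<^bsub>F\<^esub> f x)"
  by (simp_all add: cont_algebra_def)

context topological_field
begin

lemma cring_cont_algebra: "cring (cont_algebra F T S)"
  using cont_algebra_is_algebra[of S] unfolding Module.algebra_def by blast

lemma ideal_continuous:
  assumes "ideal I (cont_algebra F T S)" "f \<in> I"
  shows "continuous_map S T f"
proof -
  interpret I: ideal I "cont_algebra F T S" by fact
  have "f \<in> carrier (cont_algebra F T S)" using assms(2) by (rule I.Icarr)
  then show ?thesis by (simp add: cont_algebra_simps)
qed

lemma ideal_mult:
  assumes "ideal I (cont_algebra F T S)" "f \<in> I" "continuous_map S T k"
  shows "(\<lambda>y\<in>topspace S. k y \<otimes> f y) \<in> I"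
proof -
  interpret I: ideal I "cont_algebra F T S" by fact
  have "restrict k (topspace S) \<otimes>\<^bsub>cont_algebra F T S\<^esub> f \<in> I"
    by (rule I.I_l_closed[OF assms(2) cont_algebra_carrierI[OF assms(3)]])
  moreover have "restrict k (topspace S) \<otimes>\<^bsub>cont_algebra F T S\<^esub> f = (\<lambda>y\<in>topspace S. k y \<otimes> f y)"
    unfolding cont_algebra_simps by (rule restrict_ext) simp
  ultimately show ?thesis by simp
qed

lemma ideal_add_mult:
  assumes "ideal I (cont_algebra F T S)" "f \<in> I" "g \<in> I" "continuous_map S T k"
  shows "(\<lambda>y\<in>topspace S. f y \<oplus> k y \<otimes> g y) \<in> I"
proof -
  interpret I: ideal I "cont_algebra F T S" by fact
  have "f \<oplus>\<^bsub>cont_algebra F T S\<^esub> (\<lambda>y\<in>topspace S. k y \<otimes> g y) \<in> I"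
    by (rule additive_subgroup.a_closed[OF I.is_additive_subgroup assms(2) ideal_mult[OF assms(1,3,4)]])
  moreover have "f \<oplus>\<^bsub>cont_algebra F T S\<^esub> (\<lambda>y\<in>topspace S. k y \<otimes> g y)
      = (\<lambda>y\<in>topspace S. f y \<oplus> k y \<otimes> g y)"
    unfolding cont_algebra_simps by (rule restrict_ext) simp
  ultimately show ?thesis by simp
qed

text \<open>Constant coefficients suffice to merge two functions of the ideal without common zeros on
  a compact set.\<close>

lemma ideal_nonvanishing_if_no_compact_nhd:
  assumes S: "compact_space S" "tychonoff_over F T S"
    and no_compact_nhd: "\<And>N B. \<lbrakk>openin T N; \<zero> \<in> N; compactin T B\<rbrakk> \<Longrightarrow> \<not> N \<subseteq> B"
    and I: "ideal I (cont_algebra F T S)"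
    and no_common_zero: "\<And>x. x \<in> topspace S \<Longrightarrow> \<exists>f\<in>I. f x \<noteq> \<zero>"
  shows "\<exists>f\<in>I. \<forall>y\<in>topspace S. f y \<noteq> \<zero>"
proof -
  interpret I: ideal I "cont_algebra F T S" by fact
  define P where "P U \<longleftrightarrow> (\<exists>Y. compactin S Y \<and> U \<subseteq> Y \<and> (\<exists>f\<in>I. \<forall>y\<in>Y. f y \<noteq> \<zero>))" for U
  have "P (topspace S)"
  proof (rule compact_space_induct[OF S(1)])
    have "\<zero>\<^bsub>cont_algebra F T S\<^esub> \<in> I" by (rule additive_subgroup.zero_closed[OF I.is_additive_subgroup])
    then show "P {}" unfolding P_def by blast
  next
    fix U V assume "P U" "P V"
    obtain Y f where Y: "compactin S Y" "U \<subseteq> Y" "f \<in> I" "\<forall>y\<in>Y. f y \<noteq> \<zero>"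
      using \<open>P U\<close> unfolding P_def by blast
    obtain Z g where Z: "compactin S Z" "V \<subseteq> Z" "g \<in> I" "\<forall>y\<in>Z. g y \<noteq> \<zero>"
      using \<open>P V\<close> unfolding P_def by blast
    have YZ: "compactin S (Y \<union> Z)" by (rule compactin_Un[OF Y(1) Z(1)])
    have top: "topspace (subtopology S (Y \<union> Z)) = Y \<union> Z"
      using compactin_subset_topspace[OF YZ] by auto
    have cont: "continuous_map S T f" "continuous_map S T g"
      using ideal_continuous[OF I] Y(3) Z(3) by blast+
    have "\<exists>c\<in>carrier F. \<forall>y\<in>topspace (subtopology S (Y \<union> Z)). f y \<noteq> c \<otimes> g y"
    proof (rule nonvanishing_combination[OF compact_space_subtopology[OF YZ]
          continuous_map_from_subtopology[OF cont(1)] continuous_map_from_subtopology[OF cont(2)]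
          _ no_compact_nhd])
      show "f y \<noteq> \<zero> \<or> g y \<noteq> \<zero>" if "y \<in> topspace (subtopology S (Y \<union> Z))" for y
        using that Y(4) Z(4) unfolding top by blast
    qed
    then obtain c where c: "c \<in> carrier F" "\<And>y. y \<in> Y \<union> Z \<Longrightarrow> f y \<noteq> c \<otimes> g y"
      unfolding top by blast
    define h where "h = (\<lambda>y\<in>topspace S. f y \<oplus> (\<ominus> c) \<otimes> g y)"
    have "h \<in> I"
      unfolding h_def using c(1) by (intro ideal_add_mult[OF I Y(3) Z(3)]) (simp add: topspace_eq)
    moreover have "h y \<noteq> \<zero>" if y: "y \<in> Y \<union> Z" for y
    proof -
      have yS: "y \<in> topspace S" using y compactin_subset_topspace[OF YZ] by blast
      have "f y \<in> carrier F" "g y \<in> carrier F"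
        by (rule continuous_map_carrier[OF cont(1) yS], rule continuous_map_carrier[OF cont(2) yS])
      moreover from this have "h y = f y \<ominus> c \<otimes> g y"
        using c(1) yS by (simp add: h_def a_minus_def l_minus)
      ultimately show ?thesis using c y by simp
    qed
    ultimately show "P (U \<union> V)"
      unfolding P_def using YZ Y(2) Z(2) by (intro exI[of _ "Y \<union> Z"]) blast
  next
    fix x assume "x \<in> topspace S"
    then obtain f where f: "f \<in> I" "f x \<noteq> \<zero>" using no_common_zero by blast
    have "openin S {y \<in> topspace S. f y \<noteq> \<zero>}"
      by (rule openin_support[OF ideal_continuous[OF I f(1)]])
    moreover have "x \<in> {y \<in> topspace S. f y \<noteq> \<zero>}" using f(2) \<open>x \<in> topspace S\<close> by simp
    ultimately obtain U Y where UY: "openin S U" "closedin S Y" "x \<in> U" "U \<subseteq> Y"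
        "Y \<subseteq> {y \<in> topspace S. f y \<noteq> \<zero>}"
      by (rule compact_tychonoff_shrink[OF S])
    have "compactin S Y" by (rule closedin_compact_space[OF S(1) UY(2)])
    moreover have "\<forall>y\<in>Y. f y \<noteq> \<zero>" using UY(5) by blast
    ultimately have "P U" unfolding P_def using UY(4) f(1) by blast
    then show "\<exists>U. openin S U \<and> x \<in> U \<and> P U" using UY(1,3) by blast
  qed
  then obtain Y f where "topspace S \<subseteq> Y" "f \<in> I" "\<forall>y\<in>Y. f y \<noteq> \<zero>"
    unfolding P_def by blast
  then show ?thesis by blast
qed

text \<open>The sets on which some function of the ideal equals one are closed under finite unions, by
  \<open>1 - (1 - f) (1 - g)\<close>. They include a neighbourhood of each point: a bump function supported
  where \<open>f\<close> has no zero is a multiple of \<open>f\<close>.\<close>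

lemma ideal_nonvanishing_if_compact_nhd:
  assumes S: "compact_space S" "tychonoff_over F T S"
    and nhd: "openin T N" "\<zero> \<in> N" "compactin T B" "N \<subseteq> B"
    and I: "ideal I (cont_algebra F T S)"
    and no_common_zero: "\<And>x. x \<in> topspace S \<Longrightarrow> \<exists>f\<in>I. f x \<noteq> \<zero>"
  shows "\<exists>f\<in>I. \<forall>y\<in>topspace S. f y \<noteq> \<zero>"
proof -
  interpret I: ideal I "cont_algebra F T S" by fact
  define P where "P U \<longleftrightarrow> (\<exists>f\<in>I. \<forall>y\<in>U \<inter> topspace S. f y = \<one>)" for U
  have "P (topspace S)"
  proof (rule compact_space_induct[OF S(1)])
    have "\<zero>\<^bsub>cont_algebra F T S\<^esub> \<in> I" by (rule additive_subgroup.zero_closed[OF I.is_additive_subgroup])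
    then show "P {}" unfolding P_def by blast
  next
    fix U V assume "P U" "P V"
    obtain f where f: "f \<in> I" "\<forall>y\<in>U \<inter> topspace S. f y = \<one>"
      using \<open>P U\<close> unfolding P_def by blast
    obtain g where g: "g \<in> I" "\<forall>y\<in>V \<inter> topspace S. g y = \<one>"
      using \<open>P V\<close> unfolding P_def by blast
    have cont: "continuous_map S T f" "continuous_map S T g"
      using ideal_continuous[OF I] f(1) g(1) by blast+
    define h where "h = (\<lambda>y\<in>topspace S. f y \<oplus> (\<one> \<ominus> f y) \<otimes> g y)"
    have "h \<in> I"
      unfolding h_def
      by (intro ideal_add_mult[OF I f(1) g(1)] continuous_map_diff cont) (simp add: topspace_eq)
    moreover have "h y = \<one>" if y: "y \<in> (U \<union> V) \<inter> topspace S" for y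
    proof -
      have F: "f y \<in> carrier F" "g y \<in> carrier F"
        using continuous_map_carrier[OF cont(1)] continuous_map_carrier[OF cont(2)] y by simp_all
      from y consider "f y = \<one>" | "g y = \<one>" using f(2) g(2) by blast
      then show ?thesis
      proof cases
        case 1
        then show ?thesis using F y by (simp add: h_def a_minus_def r_neg)
      next
        case 2
        have "f y \<oplus> (\<one> \<ominus> f y) = \<one>"
          using F by (simp add: a_minus_def a_lcomm[of "f y" \<one> "\<ominus> f y"] r_neg)
        then show ?thesis using 2 F y by (simp add: h_def)
      qed
    qed
    ultimately show "P (U \<union> V)" unfolding P_def by blast
  next
    fix x assume "x \<in> topspace S"
    then obtain f where f: "f \<in> I" "f x \<noteq> \<zero>" using no_common_zero by blast
    have cont: "continuous_map S T f" by (rule ideal_continuous[OF I f(1)])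
    define V where "V = {y \<in> topspace S. f y \<noteq> \<zero>}"
    have V: "openin S V" "x \<in> V"
      unfolding V_def using openin_support[OF cont] f(2) \<open>x \<in> topspace S\<close> by auto
    obtain U Y where UY: "openin S U" "closedin S Y" "x \<in> U" "U \<subseteq> Y" "Y \<subseteq> V"
      by (rule compact_tychonoff_shrink[OF S V])
    obtain h W where h: "continuous_map S T h" "openin S W" "x \<in> W" "W \<subseteq> U"
        "\<And>y. y \<in> W \<Longrightarrow> h y = \<one>" "\<And>y. y \<in> topspace S - U \<Longrightarrow> h y = \<zero>"
      by (rule bump_function[OF S nhd UY(1,3)]) blast
    define q where "q y = (if f y = \<zero> then \<zero> else inv (f y) \<otimes> h y)" for y
    have inv_f: "inv (f y) \<in> carrier F" "inv (f y) \<otimes> f y = \<one>" if "y \<in> V" for y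
      using that continuous_map_carrier[OF cont] by (simp_all add: V_def field_Units)
    have "continuous_map S T q"
    proof (rule pasting_lemma[of "{V, topspace S - Y}" _ id _ "\<lambda>_. q"])
      show "openin S (id W)" if "W \<in> {V, topspace S - Y}" for W
        using that V(1) UY(2) by auto
      show "continuous_map (subtopology S (id W)) T q" if "W \<in> {V, topspace S - Y}" for W
      proof (cases "W = V")
        case True
        have "continuous_map (subtopology S V) T (\<lambda>y. inv (f y) \<otimes> h y)"
          by (intro continuous_map_mult continuous_map_inv continuous_map_from_subtopology cont h(1))
            (simp add: V_def)
        then show ?thesis
          unfolding True id_apply by (rule continuous_map_eq) (simp add: V_def q_def)
      next
        case False
        have "continuous_map (subtopology S (topspace S - Y)) T (\<lambda>_. \<zero>)"
          by (simp add: topspace_eq)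
        moreover have "\<zero> = q y" if y: "y \<in> topspace (subtopology S (topspace S - Y))" for y
        proof (cases "f y = \<zero>")
          case False
          have "y \<in> topspace S - U" "y \<in> V" using y UY(4) False by (auto simp: V_def)
          then show ?thesis using h(6) inv_f(1) by (simp add: q_def)
        qed (simp add: q_def)
        ultimately have "continuous_map (subtopology S (topspace S - Y)) T q"
          by (rule continuous_map_eq)
        then show ?thesis using False that by auto
      qed
      show "\<exists>W. W \<in> {V, topspace S - Y} \<and> y \<in> id W \<and> q y = q y" if "y \<in> topspace S" for y
        using that UY(5) by auto
    qed simp
    then have "(\<lambda>y\<in>topspace S. q y \<otimes> f y) \<in> I"
      by (rule ideal_mult[OF I f(1)])
    moreover have "q y \<otimes> f y = \<one>" if "y \<in> W" for y
    proof -
      have "y \<in> V" using that h(4) UY(4,5) by blast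
      then show ?thesis using inv_f[of y] h(5)[OF that] by (simp add: q_def V_def)
    qed
    ultimately have "P W" unfolding P_def by (intro bexI) auto
    then show "\<exists>U. openin S U \<and> x \<in> U \<and> P U" using h(2,3) by blast
  qed
  then obtain f where "f \<in> I" "\<forall>y\<in>topspace S. f y = \<one>" unfolding P_def by blast
  then show ?thesis by (intro bexI[of _ f]) simp_all
qed

lemma ideal_without_common_zero_eq_carrier:
  assumes S: "compact_space S" "tychonoff_over F T S"
    and I: "ideal I (cont_algebra F T S)"
    and no_common_zero: "\<And>x. x \<in> topspace S \<Longrightarrow> \<exists>f\<in>I. f x \<noteq> \<zero>"
  shows "I = carrier (cont_algebra F T S)"
proof -
  have "\<exists>f\<in>I. \<forall>y\<in>topspace S. f y \<noteq> \<zero>"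
  proof (cases "\<exists>N B. openin T N \<and> \<zero> \<in> N \<and> compactin T B \<and> N \<subseteq> B")
    case True
    then obtain N B where "openin T N" "\<zero> \<in> N" "compactin T B" "N \<subseteq> B" by blast
    then show ?thesis by (rule ideal_nonvanishing_if_compact_nhd[OF S _ _ _ _ I no_common_zero])
  next
    case False
    then show ?thesis by (intro ideal_nonvanishing_if_no_compact_nhd[OF S _ I no_common_zero]) blast+
  qed
  then obtain f where f: "f \<in> I" "\<forall>y\<in>topspace S. f y \<noteq> \<zero>" by blast
  have cont: "continuous_map S T f" by (rule ideal_continuous[OF I f(1)])
  have "continuous_map S T (\<lambda>y. inv (f y))"
    using f(2) by (intro continuous_map_inv cont) blast
  then have "(\<lambda>y\<in>topspace S. inv (f y) \<otimes> f y) \<in> I" by (rule ideal_mult[OF I f(1)])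
  moreover have "(\<lambda>y\<in>topspace S. inv (f y) \<otimes> f y) = \<one>\<^bsub>cont_algebra F T S\<^esub>"
    unfolding cont_algebra_simps
    using continuous_map_carrier[OF cont] f(2) by (intro restrict_ext) (simp add: field_Units)
  ultimately show ?thesis by (intro ideal.one_imp_carrier[OF I]) simp
qed

section \<open>Maximal ideals are the points\<close>

lemma evaluation_ring_hom:
  assumes "x \<in> topspace S"
  shows "ring_hom_ring (cont_algebra F T S) F (\<lambda>f. f x)"
proof (rule ring_hom_ringI2)
  show "ring (cont_algebra F T S)" using cring_cont_algebra by (rule cring.axioms(1))
  show "ring F" by (rule is_ring)
  show "(\<lambda>f. f x) \<in> ring_hom (cont_algebra F T S) F"
    using assms by (intro ring_hom_memI) (auto simp: cont_algebra_simps intro: continuous_map_carrier)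
qed

text \<open>A maximal ideal has a common zero, so it is contained in the kernel of an evaluation, which
  is a proper ideal.\<close>

lemma maximal_ideal_eq_point:
  assumes S: "compact_space S" "tychonoff_over F T S"
    and M: "M \<in> Max_spec (cont_algebra F T S)"
  obtains x where "x \<in> topspace S" "M = {f \<in> carrier (cont_algebra F T S). f x = \<zero>}"
proof -
  interpret M: maximalideal M "cont_algebra F T S"
    using M by (simp add: Max_spec_def)
  obtain x where x: "x \<in> topspace S" "\<forall>f\<in>M. f x = \<zero>"
    using ideal_without_common_zero_eq_carrier[OF S M.is_ideal] M.I_notcarr by metis
  interpret ev: ring_hom_ring "cont_algebra F T S" F "\<lambda>f. f x"
    by (rule evaluation_ring_hom[OF x(1)])
  let ?M = "{f \<in> carrier (cont_algebra F T S). f x = \<zero>}"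
  have "ideal ?M (cont_algebra F T S)"
    using ev.kernel_is_ideal unfolding a_kernel_def' .
  moreover have "M \<subseteq> ?M" using x(2) M.Icarr by auto
  ultimately have "?M = M \<or> ?M = carrier (cont_algebra F T S)"
    by (rule M.I_maximal) auto
  moreover have "\<one>\<^bsub>cont_algebra F T S\<^esub> \<notin> ?M"
    using x(1) by (simp add: cont_algebra_simps)
  then have "?M \<noteq> carrier (cont_algebra F T S)" using M.one_closed by metis
  ultimately have "M = ?M" by blast
  then show ?thesis by (rule that[OF x(1)])
qed

lemma ev_point:
  assumes x: "x \<in> topspace S" and a: "a \<in> carrier (cont_algebra F T S)"
    and M: "M = {f \<in> carrier (cont_algebra F T S). f x = \<zero>}"
  shows "ev F (cont_algebra F T S) a M = a x"
proof -
  let ?A = "cont_algebra F T S"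
  interpret ev: ring_hom_ring ?A F "\<lambda>f. f x"
    by (rule evaluation_ring_hom[OF x])
  have "ideal M ?A"
    using ev.kernel_is_ideal unfolding a_kernel_def' M .
  have coset_eq: "M +>\<^bsub>?A\<^esub> f = M +>\<^bsub>?A\<^esub> g \<longleftrightarrow> f x = g x"
    if fg: "f \<in> carrier ?A" "g \<in> carrier ?A" for f g
  proof -
    have "(f \<ominus>\<^bsub>?A\<^esub> g) x = f x \<ominus> g x"
      using ev.hom_add[OF fg(1) ev.R.a_inv_closed[OF fg(2)]] ev.hom_a_inv[OF fg(2)]
      by (simp add: a_minus_def)
    then have "f \<ominus>\<^bsub>?A\<^esub> g \<in> M \<longleftrightarrow> f x = g x"
      using ev.R.minus_closed[OF fg] ev.hom_closed[OF fg(1)] ev.hom_closed[OF fg(2)] by (simp add: M)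
    then show ?thesis using ev.R.quotient_eq_iff_same_a_r_cos[OF \<open>ideal M ?A\<close> fg] by simp
  qed
  have const: "c \<odot>\<^bsub>?A\<^esub> \<one>\<^bsub>?A\<^esub> \<in> carrier ?A" "(c \<odot>\<^bsub>?A\<^esub> \<one>\<^bsub>?A\<^esub>) x = c" if "c \<in> carrier F" for c
  proof -
    have "c \<odot>\<^bsub>?A\<^esub> \<one>\<^bsub>?A\<^esub> = (\<lambda>y\<in>topspace S. c)"
      unfolding cont_algebra_simps using that by (intro restrict_ext) simp
    then show "c \<odot>\<^bsub>?A\<^esub> \<one>\<^bsub>?A\<^esub> \<in> carrier ?A" "(c \<odot>\<^bsub>?A\<^esub> \<one>\<^bsub>?A\<^esub>) x = c"
      using that x cont_algebra_carrierI[of S "\<lambda>_. c"] by (simp_all add: topspace_eq)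
  qed
  have "inj_on (scalar_coset ?A M) (carrier F)"
    using coset_eq const unfolding scalar_coset_def by (intro inj_onI) metis
  moreover have ax: "a x \<in> carrier F" using ev.hom_closed[OF a] .
  moreover have "scalar_coset ?A M (a x) = M +>\<^bsub>?A\<^esub> a"
    unfolding scalar_coset_def using coset_eq[OF const(1)[OF ax] a] const(2)[OF ax] by simp
  ultimately show ?thesis
    unfolding ev_def by (intro the_inv_into_f_eq)
qed

end

theorem corollary9:
  fixes F :: "('f, 'm) ring_scheme" and T :: "'f topology" and S :: "'s topology"
  assumes "topological_field F T"
    and "compact_space S"
    and "tychonoff_over F T S"
  shows "zariski_topology (cont_algebra F T S) = gelfand_topology F T (cont_algebra F T S)"
proof -
  interpret topological_field F T by fact
  let ?A = "cont_algebra F T S"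
  note point = maximal_ideal_eq_point[OF assms(2,3)]
  have zariski_gelfand: "openin (gelfand_topology F T ?A) (zariski_open ?A a)" if a: "a \<in> carrier ?A" for a
  proof -
    have "ev F ?A a M \<in> carrier F - {\<zero>\<^bsub>F\<^esub>} \<longleftrightarrow> a \<notin> M"
      if M: "M \<in> Max_spec ?A" for M
    proof -
      obtain x where x: "x \<in> topspace S" "M = {f \<in> carrier ?A. f x = \<zero>\<^bsub>F\<^esub>}"
        by (rule point[OF M])
      have "a x \<in> carrier F"
        using a x(1) by (auto simp: cont_algebra_simps intro: continuous_map_carrier)
      then show ?thesis using ev_point[OF x(1) a x(2)] a x(2) by simp
    qed
    then have "zariski_open ?A a = {M \<in> Max_spec ?A. ev F ?A a M \<in> carrier F - {\<zero>\<^bsub>F\<^esub>}}"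
      unfolding zariski_open_def by blast
    then show ?thesis
      unfolding gelfand_topology_def using a openin_nonzero
      by (intro topology_generated_by_Basis) blast
  qed
  have gelfand_zariski: "openin (zariski_topology ?A) {M \<in> Max_spec ?A. ev F ?A a M \<in> U}"
    if a: "a \<in> carrier ?A" and U: "openin T U" for a U
  proof (subst openin_subopen, intro ballI)
    fix M assume "M \<in> {M \<in> Max_spec ?A. ev F ?A a M \<in> U}"
    then have M: "M \<in> Max_spec ?A" "ev F ?A a M \<in> U" by simp_all
    obtain x where x: "x \<in> topspace S" "M = {f \<in> carrier ?A. f x = \<zero>\<^bsub>F\<^esub>}"
      by (rule point[OF M(1)])
    define V where "V = {y \<in> topspace S. a y \<in> U}"
    have "openin S V"
      unfolding V_def using a U by (intro openin_continuous_map_preimage) (auto simp: cont_algebra_simps)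
    moreover have "x \<in> V" using M(2) ev_point[OF x(1) a x(2)] x(1) by (simp add: V_def)
    ultimately have "closedin S (topspace S - V) \<and> x \<in> topspace S - (topspace S - V)"
      using x(1) by blast
    from tychonoff_overD[OF assms(3) this] obtain f where
      f: "continuous_map S T f" "f x = \<one>\<^bsub>F\<^esub>" "\<forall>y\<in>topspace S - V. f y = \<zero>\<^bsub>F\<^esub>" by blast
    define g where "g = restrict f (topspace S)"
    have g: "g \<in> carrier ?A" unfolding g_def by (rule cont_algebra_carrierI[OF f(1)])
    have "openin (zariski_topology ?A) (zariski_open ?A g)"
      unfolding zariski_topology_def using g by (intro topology_generated_by_Basis) blast
    moreover have "M \<in> zariski_open ?A g"
      using M(1) x f(2) by (simp add: zariski_open_def g_def)
    moreover have "zariski_open ?A g \<subseteq> {M \<in> Max_spec ?A. ev F ?A a M \<in> U}"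
    proof
      fix M' assume M': "M' \<in> zariski_open ?A g"
      then have max: "M' \<in> Max_spec ?A" and "g \<notin> M'" by (simp_all add: zariski_open_def)
      obtain y where y: "y \<in> topspace S" "M' = {f \<in> carrier ?A. f y = \<zero>\<^bsub>F\<^esub>}"
        by (rule point[OF max])
      have "f y \<noteq> \<zero>\<^bsub>F\<^esub>" using \<open>g \<notin> M'\<close> g y by (simp add: g_def)
      then have "a y \<in> U" using f(3) y(1) by (auto simp: V_def)
      then show "M' \<in> {M \<in> Max_spec ?A. ev F ?A a M \<in> U}"
        using max ev_point[OF y(1) a y(2)] by simp
    qed
    ultimately show "\<exists>W. openin (zariski_topology ?A) W \<and> M \<in> W \<and>
        W \<subseteq> {M \<in> Max_spec ?A. ev F ?A a M \<in> U}" by blast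
  qed
  have "openin (gelfand_topology F T ?A) W" if "openin (zariski_topology ?A) W" for W
    using that unfolding zariski_topology_def openin_topology_generated_by_iff
    by (rule generate_topology_on_coarsest[rotated 2])
      (use zariski_gelfand in \<open>auto simp: istopology_openin\<close>)
  moreover have "openin (zariski_topology ?A) W" if "openin (gelfand_topology F T ?A) W" for W
    using that unfolding gelfand_topology_def openin_topology_generated_by_iff
    by (rule generate_topology_on_coarsest[rotated 2])
      (use gelfand_zariski in \<open>auto simp: istopology_openin\<close>)
  ultimately show ?thesis unfolding topology_eq by blast
qed

end
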